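(* Let $d\ge 1$, let $M,N:\mathbb{R}^d\to\mathrm{vect}_k$ be finitely presentable persistence modules, and let $\mathcal{I},\mathcal{J}\subset\mathrm{Int}(\mathbb{R}^d)$ be nonempty. Then: (i) $\hat d(\mathcal{I},\mathcal{J})\le \hat d_{\mathrm{E}}\big((\mathrm{dgm}_M,\mathcal{I}),(\mathrm{dgm}_N,\mathcal{J})\big)$. (ii) If $\mathcal{I}=\mathcal{J}$ is closed under thickening, then $\hat d_{\mathrm{E}}\big((\mathrm{dgm}_M,\mathcal{I}),(\mathrm{dgm}_N,\mathcal{J})\big)\le d_{\mathrm{E}}(\mathrm{dgm}_M^{\mathcal{I}},\mathrm{dgm}_N^{\mathcal{I}})$. (iii) If $M\cong N$ or $\mathrm{dgm}_M=\mathrm{dgm}_N$, then $\hat d_{\mathrm{E}}\big((\mathrm{dgm}_M,\mathcal{I}),(\mathrm{dgm}_N,\mathcal{J})\big)=\hat d(\mathcal{I},\mathcal{J})$.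
   Context: Fix a field $k$; $\mathrm{vect}_k$ is the category of finite-dimensional $k$-vector spaces. $\mathbb{R}^d$ carries the product partial order and is regarded as a category. A persistence module over $\mathbb{R}^d$ is a functor $M:\mathbb{R}^d\to\mathrm{vect}_k$. An interval of a poset $P$ is a nonempty subset $I\subseteq P$ that is convex ($p,q\in I$, $p\le r\le q$ imply $r\in I$) and connected (any two elements of $I$ are joined by a finite sequence in $I$ whose consecutive terms are comparable). $\mathrm{Int}(P)$ is the set of intervals of $P$. For $I\in\mathrm{Int}(P)$, the interval module $k_I$ is $k$ on $I$, $0$ elsewhere, with identity maps within $I$ and zero maps otherwise. For $p\in P$, $p^\uparrow=\{q:p\le q\}$. $M$ is finitely presentable if it is isomorphic to the cokernel of a morphism $\bigoplus_{a\in A}k_{a^\uparrow}\to\bigoplus_{b\in B}k_{b^\uparrow}$ with $A,B$ finite multisets of elements of $P$. The generalized rank of a persistence module over a connected poset is the rank of the canonical map from its limit to its colimit. For $I\in\mathrm{Int}(\mathbb{R}^d)$, $\mathrm{rk}_M(I)$ is the generalized rank of the restriction $M|_I$; for nonempty $\mathcal{I}\subset\mathrm{Int}(\mathbb{R}^d)$, $\mathrm{rk}_M^{\mathcal{I}}$ is the restriction of $\mathrm{rk}_M$ to $\mathcal{I}$. The generalized persistence diagram (GPD) over $\mathcal{I}$ is the function $\mathrm{dgm}_M^{\mathcal{I}}:\mathcal{I}\to\mathbb{Z}$ with $\mathrm{rk}_M(I)=\sum_{J\in\mathcal{I},\,J\supseteq I}\mathrm{dgm}_M^{\mathcal{I}}(J)$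 for all $I\in\mathcal{I}$; it is unique when it exists, and then $\mathrm{dgm}_M^{\mathcal I}$ and $\mathrm{rk}_M^{\mathcal I}$ determine each other. For finitely presentable $M$ the GPD over all of $\mathrm{Int}(\mathbb{R}^d)$ exists and is denoted $\mathrm{dgm}_M$ (so $\mathrm{dgm}_M$ and $\mathrm{rk}_M$ determine each other). For $\epsilon\ge 0$, the $\epsilon$-thickening of $I$ is $I^\epsilon=\{q\in\mathbb{R}^d: \exists p\in I,\ \|p-q\|_\infty\le\epsilon\}$. A set $\mathcal{I}\subset\mathrm{Int}(\mathbb{R}^d)$ is closed under thickening if $I^\epsilon\in\mathcal{I}$ for all $I\in\mathcal{I}$, $\epsilon\ge0$. For $\mathcal{I}$ closed under thickening, the erosion distance (a quantity depending only on $\mathrm{rk}_M^{\mathcal I},\mathrm{rk}_N^{\mathcal I}$) is $$d_{\mathrm{E}}(\mathrm{dgm}_M^{\mathcal{I}},\mathrm{dgm}_N^{\mathcal{I}}):=\inf\{\epsilon>0:\forall I\in\mathcal{I},\ \mathrm{rk}_N(I^\epsilon)\le\mathrm{rk}_M(I)\text{ and }\mathrm{rk}_M(I^\epsilon)\le\mathrm{rk}_N(I)\}.$$ A correspondence between nonempty sets $A,B$ is a subset $\mathcal{R}\subset A\times B$ whose projections to $A$ and to $B$ are surjective. An $\epsilon$-correspondence between nonempty $\mathcal{I},\mathcal{J}\subset\mathrm{Int}(\mathbb{R}^d)$ is a correspondence $\mathcal{R}\subset\mathcal{I}\times\mathcal{J}$ such that $J\subset I^\epsilon$ and $I\subset J^\epsilon$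 for all $(I,J)\in\mathcal{R}$. Define $$\hat d(\mathcal{I},\mathcal{J}):=\inf\{\epsilon>0:\text{there exists an }\epsilon\text{-correspondence between }\mathcal{I}\text{ and }\mathcal{J}\},$$ and the sparse erosion distance $\hat d_{\mathrm{E}}\big((\mathrm{dgm}_M,\mathcal{I}),(\mathrm{dgm}_N,\mathcal{J})\big)$ as the infimum of all $\epsilon>0$ for which there exists an $\epsilon$-correspondence $\mathcal{R}\subset\mathcal{I}\times\mathcal{J}$ such that for all $(I,J)\in\mathcal{R}$ and all $\delta\ge0$: $\mathrm{rk}_N(J^{\epsilon+\delta})\le\mathrm{rk}_M(I^\delta)$ and $\mathrm{rk}_M(I^{\epsilon+\delta})\le\mathrm{rk}_N(J^\delta)$. Infima over the empty set are $+\infty$.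
   Formalization: In (iii), the case dgm_M = dgm_N assumes that both diagrams exist (with finite sums) and, for d ≥ 3, that every thickening I^ε of a member of 𝓘 or 𝓙 is again an interval; for d ≥ 3 this can fail, and rk_M(I^ε) is then undefined. *)

theory Defs
  imports "HOL-Analysis.Analysis" "HOL-Algebra.AbelCoset"
    "Jordan_Normal_Form.Missing_VectorSpace"
begin

section \<open>Constructions on vector spaces\<close>

text \<open>
  Vector spaces over a field \<open>K\<close> are modules in the sense of HOL-Algebra, i.e. records with a
  carrier set. The ring fields \<open>mult\<close> and \<open>one\<close> of the record type carry no meaning.
\<close>

definition prod_space :: "'i set \<Rightarrow> ('i \<Rightarrow> ('k, 'v) module) \<Rightarrow> ('k, 'i \<Rightarrow> 'v) module" where
  "prod_space S V =
    \<lparr>carrier = (\<Pi>\<^sub>E i\<in>S. carrier (V i)), mult = (\<lambda>_ _. undefined), one = undefined,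
     zero = (\<lambda>i\<in>S. \<zero>\<^bsub>V i\<^esub>), add = (\<lambda>f g. \<lambda>i\<in>S. f i \<oplus>\<^bsub>V i\<^esub> g i),
     smult = (\<lambda>c f. \<lambda>i\<in>S. c \<odot>\<^bsub>V i\<^esub> f i)\<rparr>"

definition sum_space :: "'i set \<Rightarrow> ('i \<Rightarrow> ('k, 'v) module) \<Rightarrow> ('k, 'i \<Rightarrow> 'v) module" where
  "sum_space S V = (prod_space S V)
     \<lparr>carrier := {f \<in> carrier (prod_space S V). finite {i\<in>S. f i \<noteq> \<zero>\<^bsub>V i\<^esub>}}\<rparr>"

definition sum_inj :: "'i set \<Rightarrow> ('i \<Rightarrow> ('k, 'v) module) \<Rightarrow> 'i \<Rightarrow> 'v \<Rightarrow> ('i \<Rightarrow> 'v)" where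
  "sum_inj S V i v = (\<lambda>j\<in>S. if j = i then v else \<zero>\<^bsub>V j\<^esub>)"

text \<open>
  The quotient of \<open>V\<close> by a subspace \<open>W\<close>. For a coset \<open>X\<close>, all the cosets in the union below
  coincide; the same device is used for the structure maps of a cokernel.
\<close>

definition quotient_space :: "('k, 'v) module \<Rightarrow> 'v set \<Rightarrow> ('k, 'v set) module" where
  "quotient_space V W =
    \<lparr>carrier = a_rcosets\<^bsub>V\<^esub> W, mult = (\<lambda>_ _. undefined), one = undefined,
     zero = W, add = (\<lambda>X Y. X <+>\<^bsub>V\<^esub> Y),
     smult = (\<lambda>c X. \<Union>x\<in>X. W +>\<^bsub>V\<^esub> (c \<odot>\<^bsub>V\<^esub> x))\<rparr>"

definition linear_rank ::
  "'k ring \<Rightarrow> ('k, 'v) module \<Rightarrow> ('k, 'w) module \<Rightarrow> ('v \<Rightarrow> 'w) \<Rightarrow> nat" where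
  "linear_rank K V W f = vectorspace.dim K (W\<lparr>carrier := f ` carrier V\<rparr>)"


section \<open>Intervals of a poset\<close>

definition poset_convex :: "'p::order set \<Rightarrow> bool" where
  "poset_convex I \<longleftrightarrow> (\<forall>p\<in>I. \<forall>q\<in>I. \<forall>r. p \<le> r \<and> r \<le> q \<longrightarrow> r \<in> I)"

definition poset_connected :: "'p::order set \<Rightarrow> bool" where
  "poset_connected I \<longleftrightarrow>
    (\<forall>p\<in>I. \<forall>q\<in>I. (p, q) \<in> {(a, b). a \<in> I \<and> b \<in> I \<and> (a \<le> b \<or> b \<le> a)}\<^sup>*)"

definition intervals :: "'p::order set set" where
  "intervals = {I. I \<noteq> {} \<and> poset_convex I \<and> poset_connected I}"


section \<open>Persistence modules\<close>

record ('p, 'k, 'v) pmod =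
  obj :: "'p \<Rightarrow> ('k, 'v) module"
  mor :: "'p \<Rightarrow> 'p \<Rightarrow> 'v \<Rightarrow> 'v"

locale persistence_module =
  fixes K :: "'k ring" and M :: "('p::order, 'k, 'v) pmod"
  assumes obj_vectorspace: "vectorspace K (obj M p)"
    and obj_fin_dim: "vectorspace.fin_dim K (obj M p)"
    and mor_hom: "p \<le> q \<Longrightarrow> mor M p q \<in> module_hom K (obj M p) (obj M q)"
    and mor_id: "x \<in> carrier (obj M p) \<Longrightarrow> mor M p p x = x"
    and mor_comp: "p \<le> q \<Longrightarrow> q \<le> r \<Longrightarrow> x \<in> carrier (obj M p) \<Longrightarrow>
      mor M q r (mor M p q x) = mor M p r x"

definition pmod_hom ::
  "'k ring \<Rightarrow> ('p::order, 'k, 'v) pmod \<Rightarrow> ('p, 'k, 'w) pmod \<Rightarrow> ('p \<Rightarrow> 'v \<Rightarrow> 'w) set" where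
  "pmod_hom K M N =
    {\<eta>. (\<forall>p. \<eta> p \<in> module_hom K (obj M p) (obj N p)) \<and>
        (\<forall>p q. p \<le> q \<longrightarrow>
          (\<forall>x\<in>carrier (obj M p). \<eta> q (mor M p q x) = mor N p q (\<eta> p x)))}"

definition pmod_iso :: "'k ring \<Rightarrow> ('p::order, 'k, 'v) pmod \<Rightarrow> ('p, 'k, 'w) pmod \<Rightarrow> bool" where
  "pmod_iso K M N \<longleftrightarrow>
    (\<exists>\<eta>\<in>pmod_hom K M N. \<forall>p. bij_betw (\<eta> p) (carrier (obj M p)) (carrier (obj N p)))"

definition interval_pmod :: "'k ring \<Rightarrow> 'p::order set \<Rightarrow> ('p, 'k, 'k) pmod" where
  "interval_pmod K I =
    \<lparr>obj = (\<lambda>p. \<lparr>carrier = (if p \<in> I then carrier K else {\<zero>\<^bsub>K\<^esub>}), mult = mult K, one = \<one>\<^bsub>K\<^esub>,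
                 zero = \<zero>\<^bsub>K\<^esub>, add = add K, smult = mult K\<rparr>),
     mor = (\<lambda>p q x. if p \<in> I \<and> q \<in> I then x else \<zero>\<^bsub>K\<^esub>)\<rparr>"

definition pmod_sum ::
  "'i set \<Rightarrow> ('i \<Rightarrow> ('p::order, 'k, 'v) pmod) \<Rightarrow> ('p, 'k, 'i \<Rightarrow> 'v) pmod" where
  "pmod_sum S F =
    \<lparr>obj = (\<lambda>p. sum_space S (\<lambda>i. obj (F i) p)),
     mor = (\<lambda>p q f. \<lambda>i\<in>S. mor (F i) p q (f i))\<rparr>"

definition pmod_coker ::
  "('p::order, 'k, 'v) pmod \<Rightarrow> ('p, 'k, 'w) pmod \<Rightarrow> ('p \<Rightarrow> 'v \<Rightarrow> 'w) \<Rightarrow> ('p, 'k, 'w set) pmod" where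
  "pmod_coker M N \<alpha> =
    \<lparr>obj = (\<lambda>p. quotient_space (obj N p) (\<alpha> p ` carrier (obj M p))),
     mor = (\<lambda>p q X. \<Union>x\<in>X. (\<alpha> q ` carrier (obj M q)) +>\<^bsub>obj N q\<^esub> mor N p q x)\<rparr>"

text \<open>A finite multiset of elements of the poset is listed in some order.\<close>

definition free_pmod :: "'k ring \<Rightarrow> 'p::order list \<Rightarrow> ('p, 'k, nat \<Rightarrow> 'k) pmod" where
  "free_pmod K as = pmod_sum {..<length as} (\<lambda>i. interval_pmod K {as ! i..})"

definition finitely_presentable :: "'k ring \<Rightarrow> ('p::order, 'k, 'v) pmod \<Rightarrow> bool" where
  "finitely_presentable K M \<longleftrightarrow>
    (\<exists>as bs. \<exists>\<alpha>\<in>pmod_hom K (free_pmod K as) (free_pmod K bs).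
      pmod_iso K M (pmod_coker (free_pmod K as) (free_pmod K bs) \<alpha>))"


section \<open>Generalized rank and generalized persistence diagrams\<close>

text \<open>Limit and colimit of the restriction of \<open>M\<close> to the subposet \<open>I\<close>.\<close>

definition limit_space ::
  "('p::order, 'k, 'v) pmod \<Rightarrow> 'p set \<Rightarrow> ('k, 'p \<Rightarrow> 'v) module" where
  "limit_space M I = (prod_space I (obj M))
     \<lparr>carrier := {s \<in> carrier (prod_space I (obj M)).
                   \<forall>p\<in>I. \<forall>q\<in>I. p \<le> q \<longrightarrow> mor M p q (s p) = s q}\<rparr>"

definition colimit_rel ::
  "'k ring \<Rightarrow> ('p::order, 'k, 'v) pmod \<Rightarrow> 'p set \<Rightarrow> ('p \<Rightarrow> 'v) set" where
  "colimit_rel K M I = LinearCombinations.module.span K (sum_space I (obj M))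
     {sum_inj I (obj M) q (mor M p q v) \<ominus>\<^bsub>sum_space I (obj M)\<^esub> sum_inj I (obj M) p v | p q v.
       p \<in> I \<and> q \<in> I \<and> p \<le> q \<and> v \<in> carrier (obj M p)}"

definition colimit_space ::
  "'k ring \<Rightarrow> ('p::order, 'k, 'v) pmod \<Rightarrow> 'p set \<Rightarrow> ('k, ('p \<Rightarrow> 'v) set) module" where
  "colimit_space K M I = quotient_space (sum_space I (obj M)) (colimit_rel K M I)"

definition colimit_inj ::
  "'k ring \<Rightarrow> ('p::order, 'k, 'v) pmod \<Rightarrow> 'p set \<Rightarrow> 'p \<Rightarrow> 'v \<Rightarrow> ('p \<Rightarrow> 'v) set" where
  "colimit_inj K M I p v =
    colimit_rel K M I +>\<^bsub>sum_space I (obj M)\<^esub> sum_inj I (obj M) p v"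

text \<open>
  The canonical map is the composite \<open>lim \<rightarrow> M p \<rightarrow> colim\<close> for any \<open>p \<in> I\<close>;
  it does not depend on \<open>p\<close> when \<open>I\<close> is nonempty and connected.
\<close>

definition lim_to_colim ::
  "'k ring \<Rightarrow> ('p::order, 'k, 'v) pmod \<Rightarrow> 'p set \<Rightarrow> ('p \<Rightarrow> 'v) \<Rightarrow> ('p \<Rightarrow> 'v) set" where
  "lim_to_colim K M I s = (let p = (SOME p. p \<in> I) in colimit_inj K M I p (s p))"

definition gen_rank :: "'k ring \<Rightarrow> ('p::order, 'k, 'v) pmod \<Rightarrow> 'p set \<Rightarrow> nat" where
  "gen_rank K M I =
    linear_rank K (limit_space M I) (colimit_space K M I) (lim_to_colim K M I)"

text \<open>
  The sum over \<open>{J \<in> \<I>. I \<subseteq> J}\<close>, in general an infinite set, is meaningful only if it has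
  finitely many nonzero terms, and this is part of the notion.
\<close>

definition is_gpd ::
  "'k ring \<Rightarrow> ('p::order, 'k, 'v) pmod \<Rightarrow> 'p set set \<Rightarrow> ('p set \<Rightarrow> int) \<Rightarrow> bool" where
  "is_gpd K M \<I> D \<longleftrightarrow>
    D \<in> \<I> \<rightarrow>\<^sub>E UNIV \<and>
    (\<forall>I\<in>\<I>. finite {J\<in>\<I>. I \<subseteq> J \<and> D J \<noteq> 0} \<and>
      int (gen_rank K M I) = (\<Sum>J | J \<in> \<I> \<and> I \<subseteq> J \<and> D J \<noteq> 0. D J))"

definition has_gpd :: "'k ring \<Rightarrow> ('p::order, 'k, 'v) pmod \<Rightarrow> 'p set set \<Rightarrow> bool" where
  "has_gpd K M \<I> \<longleftrightarrow> (\<exists>D. is_gpd K M \<I> D)"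

definition gpd :: "'k ring \<Rightarrow> ('p::order, 'k, 'v) pmod \<Rightarrow> 'p set set \<Rightarrow> 'p set \<Rightarrow> int" where
  "gpd K M \<I> = (THE D. is_gpd K M \<I> D)"


section \<open>Thickenings and distances\<close>

definition thickening :: "real \<Rightarrow> (real^'d) set \<Rightarrow> (real^'d) set" where
  "thickening \<epsilon> I = {q. \<exists>p\<in>I. infnorm (p - q) \<le> \<epsilon>}"

definition closed_under_thickening :: "(real^'d) set set \<Rightarrow> bool" where
  "closed_under_thickening \<I> \<longleftrightarrow> (\<forall>I\<in>\<I>. \<forall>\<epsilon>\<ge>0. thickening \<epsilon> I \<in> \<I>)"

definition correspondence :: "'a set \<Rightarrow> 'b set \<Rightarrow> ('a \<times> 'b) set \<Rightarrow> bool" where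
  "correspondence A B R \<longleftrightarrow> R \<subseteq> A \<times> B \<and> fst ` R = A \<and> snd ` R = B"

definition eps_correspondence ::
  "real \<Rightarrow> (real^'d) set set \<Rightarrow> (real^'d) set set \<Rightarrow> ((real^'d) set \<times> (real^'d) set) set \<Rightarrow> bool"
  where
  "eps_correspondence \<epsilon> \<I> \<J> R \<longleftrightarrow>
    correspondence \<I> \<J> R \<and> (\<forall>(I, J)\<in>R. J \<subseteq> thickening \<epsilon> I \<and> I \<subseteq> thickening \<epsilon> J)"

definition dhat :: "(real^'d) set set \<Rightarrow> (real^'d) set set \<Rightarrow> ereal" where
  "dhat \<I> \<J> = (INF \<epsilon>\<in>{\<epsilon>. \<epsilon> > 0 \<and> (\<exists>R. eps_correspondence \<epsilon> \<I> \<J> R)}. ereal \<epsilon>)"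

definition erosion_dist ::
  "'k ring \<Rightarrow> (real^'d) set set \<Rightarrow> (real^'d, 'k, 'v) pmod \<Rightarrow> (real^'d, 'k, 'w) pmod \<Rightarrow> ereal"
  where
  "erosion_dist K \<I> M N =
    (INF \<epsilon>\<in>{\<epsilon>. \<epsilon> > 0 \<and> (\<forall>I\<in>\<I>.
        gen_rank K N (thickening \<epsilon> I) \<le> gen_rank K M I \<and>
        gen_rank K M (thickening \<epsilon> I) \<le> gen_rank K N I)}. ereal \<epsilon>)"

definition sparse_erosion_dist ::
  "'k ring \<Rightarrow> (real^'d, 'k, 'v) pmod \<Rightarrow> (real^'d) set set \<Rightarrow>
    (real^'d, 'k, 'w) pmod \<Rightarrow> (real^'d) set set \<Rightarrow> ereal" where
  "sparse_erosion_dist K M \<I> N \<J> =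
    (INF \<epsilon>\<in>{\<epsilon>. \<epsilon> > 0 \<and> (\<exists>R. eps_correspondence \<epsilon> \<I> \<J> R \<and>
        (\<forall>(I, J)\<in>R. \<forall>\<delta>\<ge>0.
          gen_rank K N (thickening (\<epsilon> + \<delta>) J) \<le> gen_rank K M (thickening \<delta> I) \<and>
          gen_rank K M (thickening (\<epsilon> + \<delta>) I) \<le> gen_rank K N (thickening \<delta> J)))}. ereal \<epsilon>)"

end

theory Submission
  imports Defs
begin

text \<open>
  All three distances are infima over sets of \<open>\<epsilon>\<close>, so each inequality is an inclusion of such sets.

  The inequality with \<open>dhat\<close> on the left drops the rank conditions. If \<open>\<I>\<close> is closed under
  thickening, the diagonal of \<open>\<I>\<close> is an \<open>\<epsilon>\<close>-correspondence, and the rank conditions at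
  \<open>\<delta>\<close> are those of the erosion distance at the interval \<open>I\<^sup>\<delta> \<in> \<I>\<close>, because
  \<open>(I\<^sup>\<delta>)\<^sup>\<epsilon>\<close> is the \<open>(\<epsilon> + \<delta>)\<close>-thickening of \<open>I\<close> (\<open>thickening_thickening\<close>).

  For the equality, assume that \<open>M\<close> and \<open>N\<close> have the same generalized rank on all thickenings
  of members of \<open>\<I>\<close> and \<open>\<J>\<close>. Then every \<open>\<epsilon>\<close>-correspondence satisfies the rank
  conditions: \<open>I \<subseteq> J\<^sup>\<epsilon>\<close> implies that the \<open>\<delta>\<close>-thickening of \<open>I\<close> lies in the
  \<open>(\<epsilon> + \<delta>)\<close>-thickening of \<open>J\<close>, and the generalized rank can only decrease when the
  connected set grows. This monotonicity (\<open>gen_rank_antimono_iso\<close>) holds because for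
  \<open>I \<subseteq> J\<close> the canonical map \<open>lim \<rightarrow> colim\<close> over \<open>J\<close> factors through the one over \<open>I\<close>. It is proved up to an
  isomorphism of modules, and so gives the equality of the ranks of isomorphic modules as well.

  If instead the diagrams agree, then so do the ranks on all intervals, since a diagram is
  unique (\<open>is_gpd_unique\<close>) and determines the rank. This can be applied to thickenings as soon as
  they are intervals. They are always connected; they are convex in dimension at most two
  (\<open>interval_meets_box\<close>), a planar fact that may fail in higher dimensions.
\<close>

section \<open>Linear maps and dimension\<close>

lemma vector_subspaceI:
  assumes "vectorspace K V" "W \<subseteq> carrier V" "\<zero>\<^bsub>V\<^esub> \<in> W"
    and "\<And>x y. x \<in> W \<Longrightarrow> y \<in> W \<Longrightarrow> x \<oplus>\<^bsub>V\<^esub> y \<in> W"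
    and "\<And>c x. c \<in> carrier K \<Longrightarrow> x \<in> W \<Longrightarrow> c \<odot>\<^bsub>V\<^esub> x \<in> W"
  shows "VectorSpace.subspace K W V"
proof -
  interpret V: vectorspace K V by fact
  show ?thesis
    using assms V.module_axioms by (auto simp: VectorSpace.subspace_def LinearCombinations.submodule_def)
qed

lemma vector_subspaceD:
  assumes "VectorSpace.subspace K W V"
  shows "vectorspace K V" "W \<subseteq> carrier V" "\<zero>\<^bsub>V\<^esub> \<in> W"
    and "\<And>x y. x \<in> W \<Longrightarrow> y \<in> W \<Longrightarrow> x \<oplus>\<^bsub>V\<^esub> y \<in> W"
    and "\<And>c x. c \<in> carrier K \<Longrightarrow> x \<in> W \<Longrightarrow> c \<odot>\<^bsub>V\<^esub> x \<in> W"
  using assms by (auto simp: VectorSpace.subspace_def LinearCombinations.submodule_def)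

lemma module_homI:
  assumes "\<And>x. x \<in> carrier V \<Longrightarrow> f x \<in> carrier W"
    and "\<And>x y. x \<in> carrier V \<Longrightarrow> y \<in> carrier V \<Longrightarrow> f (x \<oplus>\<^bsub>V\<^esub> y) = f x \<oplus>\<^bsub>W\<^esub> f y"
    and "\<And>c x. c \<in> carrier K \<Longrightarrow> x \<in> carrier V \<Longrightarrow> f (c \<odot>\<^bsub>V\<^esub> x) = c \<odot>\<^bsub>W\<^esub> f x"
  shows "f \<in> module_hom K V W"
  using assms by (auto simp: module_hom_def)

lemma module_homD:
  assumes "f \<in> module_hom K V W"
  shows "\<And>x. x \<in> carrier V \<Longrightarrow> f x \<in> carrier W"
    and "\<And>x y. x \<in> carrier V \<Longrightarrow> y \<in> carrier V \<Longrightarrow> f (x \<oplus>\<^bsub>V\<^esub> y) = f x \<oplus>\<^bsub>W\<^esub> f y"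
    and "\<And>c x. c \<in> carrier K \<Longrightarrow> x \<in> carrier V \<Longrightarrow> f (c \<odot>\<^bsub>V\<^esub> x) = c \<odot>\<^bsub>W\<^esub> f x"
  using assms by (auto simp: module_hom_def)

lemma module_hom_comp:
  assumes "f \<in> module_hom K V W" "g \<in> module_hom K W X"
  shows "(\<lambda>x. g (f x)) \<in> module_hom K V X"
  using assms by (auto simp: module_hom_def Pi_iff)

lemma linear_mapI:
  assumes "vectorspace K V" "vectorspace K W" "f \<in> module_hom K V W"
  shows "linear_map K V W f"
  using assms
  by (simp add: linear_map_def mod_hom_def mod_hom_axioms_def vectorspace_def)

lemma vector_subspace_preimage:
  assumes V: "vectorspace K V" and f: "f \<in> module_hom K V W" and U: "VectorSpace.subspace K U W"
  shows "VectorSpace.subspace K {x \<in> carrier V. f x \<in> U} V"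
proof -
  interpret f: linear_map K V W f
    by (rule linear_mapI[OF V vector_subspaceD(1)[OF U] f])
  show ?thesis
    using vector_subspaceD[OF U] by (intro vector_subspaceI V) auto
qed

lemma vector_subspace_image:
  assumes "vectorspace K W" "f \<in> module_hom K V W" "VectorSpace.subspace K U V"
  shows "VectorSpace.subspace K (f ` U) W"
proof -
  interpret f: linear_map K V W f
    using assms vector_subspaceD(1) by (intro linear_mapI) auto
  note U = vector_subspaceD(2-)[OF assms(3)]
  show ?thesis
  proof (rule vector_subspaceI[OF assms(1)])
    show "f ` U \<subseteq> carrier W" using U(1) by auto
    show "\<zero>\<^bsub>W\<^esub> \<in> f ` U" using U(2) f.f0_is_0 by (metis image_eqI)
    fix x y assume "x \<in> f ` U" "y \<in> f ` U"
    then obtain a b where ab: "a \<in> U" "b \<in> U" "x = f a" "y = f b" by auto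
    then have "x \<oplus>\<^bsub>W\<^esub> y = f (a \<oplus>\<^bsub>V\<^esub> b)"
      using U(1) by (simp add: f.f_add subset_iff)
    then show "x \<oplus>\<^bsub>W\<^esub> y \<in> f ` U" using U(3) ab by blast
  next
    fix c x assume c: "c \<in> carrier K" and "x \<in> f ` U"
    then obtain a where a: "a \<in> U" "x = f a" by auto
    then have "c \<odot>\<^bsub>W\<^esub> x = f (c \<odot>\<^bsub>V\<^esub> a)"
      using U(1) c by (simp add: f.f_smult subset_iff)
    then show "c \<odot>\<^bsub>W\<^esub> x \<in> f ` U" using U(4) a c by blast
  qed
qed

lemma vector_subspace_fin_dim:
  assumes W: "VectorSpace.subspace K W V" and fin: "vectorspace.fin_dim K V"
  shows "vectorspace.fin_dim K (V\<lparr>carrier := W\<rparr>)"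
    and "vectorspace.dim K (V\<lparr>carrier := W\<rparr>) \<le> vectorspace.dim K V"
proof -
  interpret V: vectorspace K V using vector_subspaceD(1)[OF W] .
  interpret W: vectorspace K "V\<lparr>carrier := W\<rparr>" by (rule V.subspace_is_vs[OF W])
  have WV: "W \<subseteq> carrier V" using vector_subspaceD(2)[OF W] .
  have li: "V.lin_indpt S" if "S \<subseteq> W" "W.lin_indpt S" for S
    using that V.span_li_not_depend(2)[OF that(1) V.is_module[OF W]] by simp
  have bound: "finite S \<and> card S \<le> V.dim" if "S \<subseteq> W \<and> W.lin_indpt S" for S
    using that li[of S] V.li_le_dim[OF fin, of S] WV by blast
  have "\<exists>B. finite B \<and> maximal B (\<lambda>S. S \<subseteq> W \<and> W.lin_indpt S)"
  proof (rule maximal_exists[OF bound])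
    show "{} \<subseteq> W \<and> W.lin_indpt {}" by (simp add: W.lin_dep_def)
  qed
  then obtain B where B: "finite B" "maximal B (\<lambda>S. S \<subseteq> W \<and> W.lin_indpt S)" by blast
  then have basis: "W.basis B"
    using W.max_li_is_basis[of B] by simp
  then show "W.fin_dim" using B(1) by (auto simp: W.fin_dim_def W.basis_def)
  have "card B \<le> V.dim" using B(2) bound by (simp add: maximal_def)
  then show "W.dim \<le> V.dim" using W.dim_basis[OF B(1) basis] by simp
qed

text \<open>By rank-nullity, as \<open>ker f \<subseteq> ker g\<close>.\<close>
lemma dim_image_le_of_kernel_subset:
  assumes V: "vectorspace K V" "vectorspace.fin_dim K V"
    and W: "vectorspace K W" "f \<in> module_hom K V W"
    and X: "vectorspace K X" "g \<in> module_hom K V X"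
    and ker: "\<And>x. x \<in> carrier V \<Longrightarrow> f x = \<zero>\<^bsub>W\<^esub> \<Longrightarrow> g x = \<zero>\<^bsub>X\<^esub>"
  shows "vectorspace.dim K (X\<lparr>carrier := g ` carrier V\<rparr>)
    \<le> vectorspace.dim K (W\<lparr>carrier := f ` carrier V\<rparr>)"
proof -
  interpret V: vectorspace K V by fact
  interpret f: linear_map K V W f by (rule linear_mapI[OF V(1) W])
  interpret g: linear_map K V X g by (rule linear_mapI[OF V(1) X])
  have sub: "VectorSpace.subspace K f.ker (V\<lparr>carrier := g.ker\<rparr>)"
    using vector_subspaceD[OF f.kerT_is_subspace] ker
    by (intro vector_subspaceI V.subspace_is_vs g.kerT_is_subspace) (auto simp: f.ker_def g.ker_def)
  have "vectorspace.dim K (V\<lparr>carrier := f.ker\<rparr>) \<le> vectorspace.dim K (V\<lparr>carrier := g.ker\<rparr>)"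
    using vector_subspace_fin_dim(2)[OF sub
        vector_subspace_fin_dim(1)[OF g.kerT_is_subspace V(2)]] by simp
  then show ?thesis
    using f.rank_nullity[OF V(2)] g.rank_nullity[OF V(2)] by (simp add: f.im_def g.im_def)
qed

text \<open>
  A rank inequality for \<open>g\<close> factoring through \<open>f\<close>, stated by kernels so that the factor map
  itself, here from one colimit to another, never has to be constructed.
\<close>
lemma dim_image_subspace_le:
  assumes V: "VectorSpace.subspace K E V" "vectorspace.fin_dim K V" 
    and A: "VectorSpace.subspace K A V" "A \<subseteq> E"
    and W: "vectorspace K W" "f \<in> module_hom K V W"
    and X: "vectorspace K X" "g \<in> module_hom K V X"
    and ker: "\<And>x. x \<in> carrier V \<Longrightarrow> f x = \<zero>\<^bsub>W\<^esub> \<Longrightarrow> g x = \<zero>\<^bsub>X\<^esub>"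
  shows "vectorspace.dim K (X\<lparr>carrier := g ` A\<rparr>)
    \<le> vectorspace.dim K (W\<lparr>carrier := f ` E\<rparr>)"
proof -
  interpret V: vectorspace K V using V(1) by (rule vector_subspaceD)
  interpret W: vectorspace K W by fact
  let ?A = "V\<lparr>carrier := A\<rparr>" and ?E = "V\<lparr>carrier := E\<rparr>" and ?fE = "W\<lparr>carrier := f ` E\<rparr>"
  have AV: "A \<subseteq> carrier V" and EV: "E \<subseteq> carrier V"
    using A(1) V(1) by (auto dest: vector_subspaceD(2))
  have "vectorspace.dim K (X\<lparr>carrier := g ` A\<rparr>) \<le> vectorspace.dim K (W\<lparr>carrier := f ` A\<rparr>)"
  proof -
    have "f \<in> module_hom K ?A W" "g \<in> module_hom K ?A X"
      using module_homD[OF W(2)] module_homD[OF X(2)]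
      by (auto intro!: module_homI simp: subsetD[OF AV])
    then show ?thesis
      using dim_image_le_of_kernel_subset[of K ?A W f X g]
        V.subspace_is_vs[OF A(1)] vector_subspace_fin_dim(1)[OF A(1) V(2)] W(1) X(1) ker AV
      by auto
  qed
  also have "\<dots> \<le> vectorspace.dim K ?fE"
  proof -
    have fE: "vectorspace K ?fE"
      using W.subspace_is_vs vector_subspace_image[OF W V(1)] by blast
    have "f \<in> module_hom K ?E ?fE"
      using module_homD[OF W(2)] by (intro module_homI) (auto simp: subsetD[OF EV])
    then interpret f: linear_map K ?E ?fE f
      by (intro linear_mapI fE V.subspace_is_vs[OF V(1)])
    have "vectorspace.fin_dim K ?fE"
      by (rule f.rank_nullity_main(2)[OF vector_subspace_fin_dim(1)[OF V]]) simp
    moreover have "VectorSpace.subspace K (f ` A) ?fE"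
      using vector_subspaceD[OF vector_subspace_image[OF W A(1)]] A(2)
      by (intro vector_subspaceI fE) auto
    ultimately show ?thesis
      using vector_subspace_fin_dim(2) by fastforce
  qed
  finally show ?thesis .
qed

section \<open>Quotient spaces\<close>

lemma abelian_subgroup_vector_subspace:
  assumes W: "VectorSpace.subspace K W V"
  shows "abelian_subgroup W V"
proof -
  interpret V: vectorspace K V using W by (rule vector_subspaceD)
  note D = vector_subspaceD[OF W]
  have neg: "\<ominus>\<^bsub>V\<^esub> x \<in> W" if "x \<in> W" for x
    using D(5)[of "\<ominus>\<^bsub>K\<^esub> \<one>\<^bsub>K\<^esub>" x] that D(2) V.smult_minus_1[of x] by auto
  show ?thesis
  proof (rule abelian_subgroupI3[OF additive_subgroup.intro V.abelian_group_axioms])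
    show "subgroup W (add_monoid V)"
      using D neg by (intro V.add.subgroupI) (auto simp: a_inv_def)
  qed
qed

lemma coset_eq_iff:
  assumes W: "VectorSpace.subspace K W V" and x: "x \<in> carrier V" and y: "y \<in> carrier V"
  shows "W +>\<^bsub>V\<^esub> x = W +>\<^bsub>V\<^esub> y \<longleftrightarrow> x \<ominus>\<^bsub>V\<^esub> y \<in> W"
proof -
  interpret abelian_subgroup W V by (rule abelian_subgroup_vector_subspace[OF W])
  have "W +>\<^bsub>V\<^esub> x = W +>\<^bsub>V\<^esub> y \<longleftrightarrow> x \<in> W +>\<^bsub>V\<^esub> y"
    using a_repr_independence[OF _ y a_subgroup] a_rcos_self[OF x] by auto
  also have "\<dots> \<longleftrightarrow> x \<ominus>\<^bsub>V\<^esub> y \<in> W"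
    using a_rcos_module[OF y x] by (simp add: a_minus_def)
  finally show ?thesis .
qed

lemma quotient_space_operations:
  assumes W: "VectorSpace.subspace K W V" 
  shows "carrier (quotient_space V W) = (\<lambda>x. W +>\<^bsub>V\<^esub> x) ` carrier V"
    and "\<zero>\<^bsub>quotient_space V W\<^esub> = W +>\<^bsub>V\<^esub> \<zero>\<^bsub>V\<^esub>"
    and "\<And>x y. x \<in> carrier V \<Longrightarrow> y \<in> carrier V \<Longrightarrow>
      (W +>\<^bsub>V\<^esub> x) \<oplus>\<^bsub>quotient_space V W\<^esub> (W +>\<^bsub>V\<^esub> y) = W +>\<^bsub>V\<^esub> (x \<oplus>\<^bsub>V\<^esub> y)"
    and "\<And>c x. c \<in> carrier K \<Longrightarrow> x \<in> carrier V \<Longrightarrow>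
      c \<odot>\<^bsub>quotient_space V W\<^esub> (W +>\<^bsub>V\<^esub> x) = W +>\<^bsub>V\<^esub> (c \<odot>\<^bsub>V\<^esub> x)"
proof -
  interpret V: vectorspace K V using W by (rule vector_subspaceD)
  interpret abelian_subgroup W V by (rule abelian_subgroup_vector_subspace[OF W])
  show "carrier (quotient_space V W) = (\<lambda>x. W +>\<^bsub>V\<^esub> x) ` carrier V"
    by (auto simp: quotient_space_def A_RCOSETS_def')
  show "\<zero>\<^bsub>quotient_space V W\<^esub> = W +>\<^bsub>V\<^esub> \<zero>\<^bsub>V\<^esub>"
    using a_rcos_const[OF zero_closed] by (simp add: quotient_space_def)
  show "(W +>\<^bsub>V\<^esub> x) \<oplus>\<^bsub>quotient_space V W\<^esub> (W +>\<^bsub>V\<^esub> y) = W +>\<^bsub>V\<^esub> (x \<oplus>\<^bsub>V\<^esub> y)"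
    if "x \<in> carrier V" "y \<in> carrier V" for x y
    using a_rcos_sum that by (simp add: quotient_space_def)
  show "c \<odot>\<^bsub>quotient_space V W\<^esub> (W +>\<^bsub>V\<^esub> x) = W +>\<^bsub>V\<^esub> (c \<odot>\<^bsub>V\<^esub> x)"
    if c: "c \<in> carrier K" and x: "x \<in> carrier V" for c x
  proof -
    have const: "W +>\<^bsub>V\<^esub> (c \<odot>\<^bsub>V\<^esub> y) = W +>\<^bsub>V\<^esub> (c \<odot>\<^bsub>V\<^esub> x)" if y: "y \<in> W +>\<^bsub>V\<^esub> x" for y
    proof -
      have yV: "y \<in> carrier V"
        using y V.a_r_coset_subset_G[OF vector_subspaceD(2)[OF W] x] by auto
      have "y \<ominus>\<^bsub>V\<^esub> x \<in> W"
        using a_rcos_module_imp[OF x y] by (simp add: a_minus_def)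
      then have "c \<odot>\<^bsub>V\<^esub> (y \<ominus>\<^bsub>V\<^esub> x) \<in> W" using vector_subspaceD(5)[OF W c] by simp
      then have "c \<odot>\<^bsub>V\<^esub> y \<ominus>\<^bsub>V\<^esub> c \<odot>\<^bsub>V\<^esub> x \<in> W"
        using c x yV by (simp add: a_minus_def V.smult_r_distr V.smult_r_minus)
      then show ?thesis using coset_eq_iff[OF W] c x yV by simp
    qed
    have "W +>\<^bsub>V\<^esub> x \<noteq> {}"
      using a_rcos_self[OF x] by blast
    then have "(\<Union>y\<in>W +>\<^bsub>V\<^esub> x. W +>\<^bsub>V\<^esub> (c \<odot>\<^bsub>V\<^esub> y)) = W +>\<^bsub>V\<^esub> (c \<odot>\<^bsub>V\<^esub> x)"
      by (rule SUP_eq_const) (rule const)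
    then show ?thesis by (simp add: quotient_space_def)
  qed
qed

lemma vectorspace_quotient_space:
  assumes W: "VectorSpace.subspace K W V"
  shows "vectorspace K (quotient_space V W)"
proof -
  interpret V: vectorspace K V using W by (rule vector_subspaceD)
  note ops = quotient_space_operations[OF W]
  have neg: "\<exists>y\<in>carrier V. (W +>\<^bsub>V\<^esub> x) \<oplus>\<^bsub>quotient_space V W\<^esub> (W +>\<^bsub>V\<^esub> y) = \<zero>\<^bsub>quotient_space V W\<^esub>"
    if "x \<in> carrier V" for x
    using that by (intro bexI[of _ "\<ominus>\<^bsub>V\<^esub> x"]) (auto simp: ops V.r_neg)
  show ?thesis
    using neg
    by (intro vs_criteria V.field_axioms)
      (auto simp: ops V.a_ac V.smult_assoc1 V.smult_l_distr V.smult_r_distr)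
qed

lemma coset_module_hom:
  assumes W: "VectorSpace.subspace K W V"
  shows "(\<lambda>x. W +>\<^bsub>V\<^esub> x) \<in> module_hom K V (quotient_space V W)"
  by (intro module_homI) (auto simp: quotient_space_operations[OF W])

lemma coset_eq_zero_iff:
  assumes W: "VectorSpace.subspace K W V" and x: "x \<in> carrier V"
  shows "W +>\<^bsub>V\<^esub> x = \<zero>\<^bsub>quotient_space V W\<^esub> \<longleftrightarrow> x \<in> W"
proof -
  interpret V: vectorspace K V using W by (rule vector_subspaceD)
  have "x \<ominus>\<^bsub>V\<^esub> \<zero>\<^bsub>V\<^esub> = x"
    using x V.M.add.inv_one by (simp add: a_minus_def a_inv_def)
  then show ?thesis
    using coset_eq_iff[OF W x V.M.zero_closed]
    by (simp add: quotient_space_operations[OF W])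
qed

section \<open>Direct sums\<close>

lemma prod_space_simps:
  "carrier (prod_space S V) = (\<Pi>\<^sub>E i\<in>S. carrier (V i))"
  "\<zero>\<^bsub>prod_space S V\<^esub> = (\<lambda>i\<in>S. \<zero>\<^bsub>V i\<^esub>)"
  "f \<oplus>\<^bsub>prod_space S V\<^esub> g = (\<lambda>i\<in>S. f i \<oplus>\<^bsub>V i\<^esub> g i)"
  "c \<odot>\<^bsub>prod_space S V\<^esub> f = (\<lambda>i\<in>S. c \<odot>\<^bsub>V i\<^esub> f i)"
  by (simp_all add: prod_space_def)

lemma sum_space_simps:
  "carrier (sum_space S V) =
    {f \<in> (\<Pi>\<^sub>E i\<in>S. carrier (V i)). finite {i\<in>S. f i \<noteq> \<zero>\<^bsub>V i\<^esub>}}"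
  "\<zero>\<^bsub>sum_space S V\<^esub> = (\<lambda>i\<in>S. \<zero>\<^bsub>V i\<^esub>)"
  "f \<oplus>\<^bsub>sum_space S V\<^esub> g = (\<lambda>i\<in>S. f i \<oplus>\<^bsub>V i\<^esub> g i)"
  "c \<odot>\<^bsub>sum_space S V\<^esub> f = (\<lambda>i\<in>S. c \<odot>\<^bsub>V i\<^esub> f i)"
  by (simp_all add: sum_space_def prod_space_def)

lemma vectorspace_prod_space:
  assumes K: "field K" and V: "\<And>i. i \<in> S \<Longrightarrow> vectorspace K (V i)"
  shows "vectorspace K (prod_space S V)"
proof -
  note [simp] = prod_space_simps
  have M: "module K (V i)" if "i \<in> S" for i
    using V[OF that] by (simp add: vectorspace_def)
  have A: "abelian_group (V i)" if "i \<in> S" for i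
    using M[OF that] by (simp add: module_def)
  have B: "abelian_monoid (V i)" if "i \<in> S" for i
    using A[OF that] by (simp add: abelian_group_def)
  note closed = abelian_monoid.a_closed[OF B] abelian_monoid.zero_closed[OF B]
    Module.module.smult_closed[OF M]
  note ids = abelian_monoid.r_zero[OF B] Module.module.smult_assoc1[OF M]
    Module.module.smult_one[OF M] Module.module.smult_l_distr[OF M] Module.module.smult_r_distr[OF M]
    abelian_group.r_neg[OF A]
  show ?thesis
  proof (rule vs_criteria[OF K])
    show "\<forall>f\<in>carrier (prod_space S V). \<exists>g\<in>carrier (prod_space S V).
      f \<oplus>\<^bsub>prod_space S V\<^esub> g = \<zero>\<^bsub>prod_space S V\<^esub>"
    proof
      fix f assume f: "f \<in> carrier (prod_space S V)"
      show "\<exists>g\<in>carrier (prod_space S V). f \<oplus>\<^bsub>prod_space S V\<^esub> g = \<zero>\<^bsub>prod_space S V\<^esub>"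
        by (rule bexI[of _ "\<lambda>i\<in>S. \<ominus>\<^bsub>V i\<^esub> f i"])
          (use f in \<open>auto simp: PiE_iff ids abelian_group.a_inv_closed[OF A] intro!: restrict_ext\<close>)
    qed
    show "\<forall>f g. f \<in> carrier (prod_space S V) \<and> g \<in> carrier (prod_space S V) \<longrightarrow>
      f \<oplus>\<^bsub>prod_space S V\<^esub> g = g \<oplus>\<^bsub>prod_space S V\<^esub> f"
      by (auto simp: PiE_iff intro!: restrict_ext abelian_monoid.a_comm[OF B])
    show "\<forall>f g h. f \<in> carrier (prod_space S V) \<and> g \<in> carrier (prod_space S V) \<and>
        h \<in> carrier (prod_space S V) \<longrightarrow>
      f \<oplus>\<^bsub>prod_space S V\<^esub> g \<oplus>\<^bsub>prod_space S V\<^esub> h = f \<oplus>\<^bsub>prod_space S V\<^esub> (g \<oplus>\<^bsub>prod_space S V\<^esub> h)"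
      by (auto simp: PiE_iff intro!: restrict_ext abelian_monoid.a_assoc[OF B])
    show "\<forall>f\<in>carrier (prod_space S V). f \<oplus>\<^bsub>prod_space S V\<^esub> \<zero>\<^bsub>prod_space S V\<^esub> = f"
      by (auto simp: PiE_iff ids intro!: extensionalityI[where A = S])
    show "\<forall>f\<in>carrier (prod_space S V). \<one>\<^bsub>K\<^esub> \<odot>\<^bsub>prod_space S V\<^esub> f = f"
      by (auto simp: PiE_iff ids intro!: extensionalityI[where A = S])
  qed (auto simp: PiE_iff closed ids intro!: restrict_ext)
qed

lemma vectorspace_sum_space:
  assumes K: "field K" and V: "\<And>i. i \<in> S \<Longrightarrow> vectorspace K (V i)"
  shows "vectorspace K (sum_space S V)"
proof -
  note [simp] = prod_space_simps
  interpret P: vectorspace K "prod_space S V"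
    by (rule vectorspace_prod_space[OF K V])
  let ?supp = "\<lambda>f. {i\<in>S. f i \<noteq> \<zero>\<^bsub>V i\<^esub>}"
  have V0: "\<zero>\<^bsub>V i\<^esub> \<oplus>\<^bsub>V i\<^esub> \<zero>\<^bsub>V i\<^esub> = \<zero>\<^bsub>V i\<^esub>" "c \<in> carrier K \<Longrightarrow> c \<odot>\<^bsub>V i\<^esub> \<zero>\<^bsub>V i\<^esub> = \<zero>\<^bsub>V i\<^esub>"
    if "i \<in> S" for i c
  proof -
    interpret vectorspace K "V i" using V[OF that] .
    show "\<zero>\<^bsub>V i\<^esub> \<oplus>\<^bsub>V i\<^esub> \<zero>\<^bsub>V i\<^esub> = \<zero>\<^bsub>V i\<^esub>" "c \<in> carrier K \<Longrightarrow> c \<odot>\<^bsub>V i\<^esub> \<zero>\<^bsub>V i\<^esub> = \<zero>\<^bsub>V i\<^esub>"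
      by simp_all
  qed
  have add: "finite (?supp (\<lambda>i\<in>S. f i \<oplus>\<^bsub>V i\<^esub> g i))" if "finite (?supp f)" "finite (?supp g)" for f g
    by (rule finite_subset[OF _ finite_UnI[OF that]]) (use V0(1) in fastforce)
  have smult: "finite (?supp (\<lambda>i\<in>S. c \<odot>\<^bsub>V i\<^esub> f i))" if c: "c \<in> carrier K" and f: "finite (?supp f)" for c f
    by (rule finite_subset[OF _ f]) (use V0(2) c in fastforce)
  have "VectorSpace.subspace K
    {f \<in> carrier (prod_space S V). finite (?supp f)} (prod_space S V)"
  proof (rule vector_subspaceI[OF P.vectorspace_axioms])
    show "\<zero>\<^bsub>prod_space S V\<^esub> \<in> {f \<in> carrier (prod_space S V). finite (?supp f)}"
    proof -
      have "?supp \<zero>\<^bsub>prod_space S V\<^esub> = {}" by auto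
      then have "finite (?supp \<zero>\<^bsub>prod_space S V\<^esub>)" by (simp only: finite.emptyI)
      then show ?thesis using P.M.zero_closed by blast
    qed
    fix f g assume fg: "f \<in> {f \<in> carrier (prod_space S V). finite (?supp f)}"
      "g \<in> {f \<in> carrier (prod_space S V). finite (?supp f)}"
    then have "f \<oplus>\<^bsub>prod_space S V\<^esub> g \<in> carrier (prod_space S V)"
      using P.M.a_closed by blast
    then show "f \<oplus>\<^bsub>prod_space S V\<^esub> g \<in> {f \<in> carrier (prod_space S V). finite (?supp f)}"
      using add[of f g] fg by simp
  next
    fix c f assume cf: "c \<in> carrier K" "f \<in> {f \<in> carrier (prod_space S V). finite (?supp f)}"
    then have "c \<odot>\<^bsub>prod_space S V\<^esub> f \<in> carrier (prod_space S V)"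
      using P.smult_closed by blast
    then show "c \<odot>\<^bsub>prod_space S V\<^esub> f \<in> {f \<in> carrier (prod_space S V). finite (?supp f)}"
      using smult[of c f] cf by simp
  qed simp
  then show ?thesis
    using P.subspace_is_vs by (simp add: sum_space_def)
qed

lemma sum_inj_module_hom:
  assumes V: "\<And>i. i \<in> S \<Longrightarrow> vectorspace K (V i)" and i: "i \<in> S"
  shows "sum_inj S V i \<in> module_hom K (V i) (sum_space S V)"
proof -
  note [simp] = sum_space_simps
  interpret vectorspace K "V i" using V[OF i] .
  have B: "abelian_monoid (V j)" "Module.module K (V j)" if "j \<in> S" for j
    using V[OF that] by (simp_all add: vectorspace_def Module.module_def abelian_group_def)
  show ?thesis
  proof (rule module_homI)
    fix x assume x: "x \<in> carrier (V i)"
    have "finite {j \<in> S. sum_inj S V i x j \<noteq> \<zero>\<^bsub>V j\<^esub>}"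
      by (rule finite_subset[of _ "{i}"]) (auto simp: sum_inj_def)
    then show "sum_inj S V i x \<in> carrier (sum_space S V)"
      using x abelian_monoid.zero_closed[OF B(1)] by (auto simp: sum_inj_def)
  next
    fix x y assume "x \<in> carrier (V i)" "y \<in> carrier (V i)"
    then show "sum_inj S V i (x \<oplus>\<^bsub>V i\<^esub> y) = sum_inj S V i x \<oplus>\<^bsub>sum_space S V\<^esub> sum_inj S V i y"
      using abelian_monoid.r_zero[OF B(1)] abelian_monoid.zero_closed[OF B(1)]
      by (auto simp: sum_inj_def intro!: restrict_ext)
  next
    fix c x assume "c \<in> carrier K" "x \<in> carrier (V i)"
    then show "sum_inj S V i (c \<odot>\<^bsub>V i\<^esub> x) = c \<odot>\<^bsub>sum_space S V\<^esub> sum_inj S V i x"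
      using Module.module.smult_r_null[OF B(2)]
      by (auto simp: sum_inj_def intro!: restrict_ext)
  qed
qed

text \<open>
  The map of direct sums induced by maps \<open>\<phi> i\<close> for \<open>i \<in> S\<close>, followed by the inclusion of
  the summands over \<open>S\<close> into those over \<open>T \<supseteq> S\<close>.
\<close>
definition sum_map ::
  "'i set \<Rightarrow> 'i set \<Rightarrow> ('i \<Rightarrow> ('k, 'w) module) \<Rightarrow> ('i \<Rightarrow> 'v \<Rightarrow> 'w) \<Rightarrow> ('i \<Rightarrow> 'v) \<Rightarrow> ('i \<Rightarrow> 'w)" where
  "sum_map S T W \<phi> f = (\<lambda>j\<in>T. if j \<in> S then \<phi> j (f j) else \<zero>\<^bsub>W j\<^esub>)"

lemma sum_map_module_hom:
  assumes V: "\<And>i. i \<in> S \<Longrightarrow> vectorspace K (V i)" and W: "\<And>i. i \<in> T \<Longrightarrow> vectorspace K (W i)"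
    and \<phi>: "\<And>i. i \<in> S \<Longrightarrow> \<phi> i \<in> module_hom K (V i) (W i)" and ST: "S \<subseteq> T"
  shows "sum_map S T W \<phi> \<in> module_hom K (sum_space S V) (sum_space T W)"
proof -
  note [simp] = sum_space_simps
  have B: "abelian_monoid (W j)" "Module.module K (W j)" if "j \<in> T" for j
    using W[OF that] by (simp_all add: vectorspace_def Module.module_def abelian_group_def)
  have z: "\<phi> i \<zero>\<^bsub>V i\<^esub> = \<zero>\<^bsub>W i\<^esub>" if "i \<in> S" for i
  proof -
    interpret linear_map K "V i" "W i" "\<phi> i"
      using that ST by (intro linear_mapI V W \<phi>) auto
    show ?thesis by simp
  qed
  note \<phi>' = module_homD[OF \<phi>]
  show ?thesis
  proof (rule module_homI)
    fix f assume f: "f \<in> carrier (sum_space S V)"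
    have "finite {i \<in> T. sum_map S T W \<phi> f i \<noteq> \<zero>\<^bsub>W i\<^esub>}"
      by (rule finite_subset[of _ "{i\<in>S. f i \<noteq> \<zero>\<^bsub>V i\<^esub>}"])
        (use f z in \<open>auto simp: sum_map_def split: if_splits\<close>)
    then show "sum_map S T W \<phi> f \<in> carrier (sum_space T W)"
      using f \<phi>'(1) abelian_monoid.zero_closed[OF B(1)] by (auto simp: sum_map_def PiE_iff)
  next
    fix f g assume "f \<in> carrier (sum_space S V)" "g \<in> carrier (sum_space S V)"
    then show "sum_map S T W \<phi> (f \<oplus>\<^bsub>sum_space S V\<^esub> g) =
        sum_map S T W \<phi> f \<oplus>\<^bsub>sum_space T W\<^esub> sum_map S T W \<phi> g"
      using \<phi>'(2) abelian_monoid.r_zero[OF B(1)] abelian_monoid.zero_closed[OF B(1)]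
      by (auto simp: sum_map_def PiE_iff intro!: restrict_ext)
  next
    fix c f assume "c \<in> carrier K" "f \<in> carrier (sum_space S V)"
    then show "sum_map S T W \<phi> (c \<odot>\<^bsub>sum_space S V\<^esub> f) = c \<odot>\<^bsub>sum_space T W\<^esub> sum_map S T W \<phi> f"
      using \<phi>'(3) Module.module.smult_r_null[OF B(2)]
      by (auto simp: sum_map_def PiE_iff intro!: restrict_ext)
  qed
qed

lemma sum_map_sum_inj:
  assumes V: "\<And>i. i \<in> S \<Longrightarrow> vectorspace K (V i)" and W: "\<And>i. i \<in> T \<Longrightarrow> vectorspace K (W i)"
    and \<phi>: "\<And>i. i \<in> S \<Longrightarrow> \<phi> i \<in> module_hom K (V i) (W i)" and ST: "S \<subseteq> T" and p: "p \<in> S"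
  shows "sum_map S T W \<phi> (sum_inj S V p v) = sum_inj T W p (\<phi> p v)"
proof -
  have z: "\<phi> i \<zero>\<^bsub>V i\<^esub> = \<zero>\<^bsub>W i\<^esub>" if "i \<in> S" for i
  proof -
    interpret linear_map K "V i" "W i" "\<phi> i"
      using that ST by (intro linear_mapI V W \<phi>) auto
    show ?thesis by simp
  qed
  show ?thesis
    using z p ST by (auto simp: sum_map_def sum_inj_def intro!: restrict_ext)
qed

section \<open>Limits, colimits and the generalized rank\<close>

abbreviation (input) colimit_gens where
  "colimit_gens M I \<equiv> {sum_inj I (obj M) q (mor M p q v) \<ominus>\<^bsub>sum_space I (obj M)\<^esub> sum_inj I (obj M) p v | p q v.
       p \<in> I \<and> q \<in> I \<and> p \<le> q \<and> v \<in> carrier (obj M p)}"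

context persistence_module
begin

lemma field_K: "field K"
  using obj_vectorspace by (simp add: vectorspace_def)

lemma sum_inj_closed:
  assumes "p \<in> I" "v \<in> carrier (obj M p)"
  shows "sum_inj I (obj M) p v \<in> carrier (sum_space I (obj M))"
  using module_homD(1)[OF sum_inj_module_hom[where V = "obj M", OF obj_vectorspace assms(1)] assms(2)] .

lemma mor_closed: "p \<le> q \<Longrightarrow> v \<in> carrier (obj M p) \<Longrightarrow> mor M p q v \<in> carrier (obj M q)"
  using module_homD(1)[OF mor_hom] .

lemma vectorspace_sum_obj: "vectorspace K (sum_space I (obj M))"
  by (rule vectorspace_sum_space[OF field_K obj_vectorspace])

lemma colimit_gens_closed: "colimit_gens M I \<subseteq> carrier (sum_space I (obj M))"
proof -
  interpret S: vectorspace K "sum_space I (obj M)" by (rule vectorspace_sum_obj)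
  show ?thesis
    by (clarify, intro S.M.minus_closed sum_inj_closed mor_closed)
qed

lemma colimit_rel_subspace: "VectorSpace.subspace K (colimit_rel K M I) (sum_space I (obj M))"
proof -
  interpret S: vectorspace K "sum_space I (obj M)" by (rule vectorspace_sum_obj)
  show ?thesis
    using S.span_is_subspace[OF colimit_gens_closed] by (simp only: colimit_rel_def)
qed

lemma vectorspace_colimit_space: "vectorspace K (colimit_space K M I)"
  unfolding colimit_space_def by (rule vectorspace_quotient_space[OF colimit_rel_subspace])

lemma colimit_inj_module_hom:
  assumes p: "p \<in> I"
  shows "colimit_inj K M I p \<in> module_hom K (obj M p) (colimit_space K M I)"
proof -
  have "colimit_inj K M I p =
      (\<lambda>v. colimit_rel K M I +>\<^bsub>sum_space I (obj M)\<^esub> sum_inj I (obj M) p v)"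
    by (simp add: fun_eq_iff colimit_inj_def)
  then show ?thesis
    using module_hom_comp[OF sum_inj_module_hom[where V = "obj M", OF obj_vectorspace p]
        coset_module_hom[OF colimit_rel_subspace]]
    by (simp add: colimit_space_def)
qed

lemma colimit_inj_eq_zero_iff:
  assumes "p \<in> I" "v \<in> carrier (obj M p)"
  shows "colimit_inj K M I p v = \<zero>\<^bsub>colimit_space K M I\<^esub> \<longleftrightarrow>
    sum_inj I (obj M) p v \<in> colimit_rel K M I"
  using coset_eq_zero_iff[OF colimit_rel_subspace sum_inj_closed[OF assms]]
  by (simp add: colimit_inj_def colimit_space_def)

lemma colimit_inj_mor:
  assumes "p \<in> I" "q \<in> I" "p \<le> q" "v \<in> carrier (obj M p)"
  shows "colimit_inj K M I q (mor M p q v) = colimit_inj K M I p v"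
proof -
  interpret S: vectorspace K "sum_space I (obj M)" by (rule vectorspace_sum_obj)
  have "sum_inj I (obj M) q (mor M p q v) \<ominus>\<^bsub>sum_space I (obj M)\<^esub> sum_inj I (obj M) p v
      \<in> colimit_gens M I"
    using assms by blast
  also have "\<dots> \<subseteq> colimit_rel K M I"
    unfolding colimit_rel_def by (rule S.in_own_span[OF colimit_gens_closed])
  finally show ?thesis
    using coset_eq_iff[OF colimit_rel_subspace] sum_inj_closed mor_closed assms
    by (simp only: colimit_inj_def)
qed

text \<open>
  For \<open>q \<le> r\<close> the compatibility of \<open>s\<close> and the defining relations of the colimit
  identify the images of \<open>s q\<close> and \<open>s r\<close>; a zigzag in \<open>I\<close> does so for any two points.
\<close>
lemma lim_to_colim_eq:
  assumes I: "poset_connected I" and p: "p \<in> I" and s: "s \<in> carrier (limit_space M I)"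
  shows "lim_to_colim K M I s = colimit_inj K M I p (s p)"
proof -
  have s_obj: "s q \<in> carrier (obj M q)" if "q \<in> I" for q
    using s that by (auto simp: limit_space_def prod_space_simps PiE_iff)
  have step: "colimit_inj K M I q (s q) = colimit_inj K M I r (s r)"
    if "q \<in> I" "r \<in> I" "q \<le> r" for q r
  proof -
    have "mor M q r (s q) = s r" using s that by (simp add: limit_space_def prod_space_simps)
    then show ?thesis using colimit_inj_mor[OF that s_obj[OF that(1)]] by simp
  qed
  define q where "q = (SOME p. p \<in> I)"
  have q: "q \<in> I" unfolding q_def using p by (rule someI)
  have "(q, p) \<in> {(a, b). a \<in> I \<and> b \<in> I \<and> (a \<le> b \<or> b \<le> a)}\<^sup>*"
    using I q p by (simp add: poset_connected_def)
  then have "colimit_inj K M I q (s q) = colimit_inj K M I p (s p)"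
    by (induction rule: rtrancl_induct) (use step in auto)
  then show ?thesis by (simp add: lim_to_colim_def q_def)
qed

text \<open>
  Through this subspace of the finite-dimensional space \<open>obj M p\<close> the canonical map factors, so
  that dimensions never have to be counted in the limit itself.
\<close>
lemma limit_values_subspace:
  assumes p: "p \<in> I"
  shows "VectorSpace.subspace K ((\<lambda>s. s p) ` carrier (limit_space M I)) (obj M p)"
    (is "VectorSpace.subspace K ?E _")
proof (rule vector_subspaceI[OF obj_vectorspace])
  have lin: "linear_map K (obj M q) (obj M r) (mor M q r)" if "q \<le> r" for q r
    using that by (intro linear_mapI obj_vectorspace mor_hom)
  have V: "abelian_monoid (obj M q)" "Module.module K (obj M q)" for q
    using obj_vectorspace[of q] by (simp_all add: vectorspace_def Module.module_def abelian_group_def)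
  show "?E \<subseteq> carrier (obj M p)"
    using p by (auto simp: limit_space_def prod_space_simps)
  have "(\<lambda>q\<in>I. \<zero>\<^bsub>obj M q\<^esub>) \<in> carrier (limit_space M I)"
    using mod_hom.f0_is_0[OF linear_map.axioms(3)[OF lin]] abelian_monoid.zero_closed[OF V(1)]
    by (auto simp: limit_space_def prod_space_simps)
  then show "\<zero>\<^bsub>obj M p\<^esub> \<in> ?E"
    using p by (auto intro: rev_image_eqI)
  fix x y assume "x \<in> ?E" "y \<in> ?E"
  then obtain s t where st: "s \<in> carrier (limit_space M I)" "t \<in> carrier (limit_space M I)"
    "x = s p" "y = t p" by auto
  have "(\<lambda>q\<in>I. s q \<oplus>\<^bsub>obj M q\<^esub> t q) \<in> carrier (limit_space M I)"
    using st module_homD(2)[OF mor_hom] abelian_monoid.a_closed[OF V(1)]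
    by (auto simp: limit_space_def prod_space_simps PiE_iff)
  then show "x \<oplus>\<^bsub>obj M p\<^esub> y \<in> ?E"
    using p st by (auto intro: rev_image_eqI)
next
  fix c x assume c: "c \<in> carrier K" and "x \<in> ?E"
  then obtain s where s: "s \<in> carrier (limit_space M I)" "x = s p" by auto
  have V: "Module.module K (obj M q)" for q
    using obj_vectorspace[of q] by (simp add: vectorspace_def)
  have "(\<lambda>q\<in>I. c \<odot>\<^bsub>obj M q\<^esub> s q) \<in> carrier (limit_space M I)"
    using s c module_homD(3)[OF mor_hom] Module.module.smult_closed[OF V]
    by (auto simp: limit_space_def prod_space_simps PiE_iff)
  then show "c \<odot>\<^bsub>obj M p\<^esub> x \<in> ?E"
    using p s by (auto intro: rev_image_eqI)
qed

lemma gen_rank_eq: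
  assumes I: "poset_connected I" and p: "p \<in> I"
  shows "gen_rank K M I = vectorspace.dim K ((colimit_space K M I)
    \<lparr>carrier := colimit_inj K M I p ` (\<lambda>s. s p) ` carrier (limit_space M I)\<rparr>)"
  using lim_to_colim_eq[OF I p]
  by (simp add: gen_rank_def linear_rank_def image_image cong: image_cong_simp)

end

text \<open>
  Functoriality of the colimit in the module and in the index set. The preimage of the relations
  over \<open>J\<close> is a subspace, so it suffices that it contains the generators over \<open>I\<close>, and it
  does by naturality.
\<close>
lemma colimit_rel_sum_map:
  assumes M: "persistence_module K M" and N: "persistence_module K N"
    and \<eta>: "\<eta> \<in> pmod_hom K M N" and IJ: "I \<subseteq> J" and x: "x \<in> colimit_rel K M I"
  shows "sum_map I J (obj N) \<eta> x \<in> colimit_rel K N J"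
proof -
  interpret M: persistence_module K M by fact
  interpret N: persistence_module K N by fact
  let ?f = "sum_map I J (obj N) \<eta>"
  have \<eta>_hom: "\<eta> p \<in> module_hom K (obj M p) (obj N p)" for p
    using \<eta> by (simp add: pmod_hom_def)
  interpret S: vectorspace K "sum_space I (obj M)" by (rule M.vectorspace_sum_obj)
  interpret T: vectorspace K "sum_space J (obj N)" by (rule N.vectorspace_sum_obj)
  interpret f: linear_map K "sum_space I (obj M)" "sum_space J (obj N)" ?f
    by (intro linear_mapI M.vectorspace_sum_obj N.vectorspace_sum_obj sum_map_module_hom
        M.obj_vectorspace N.obj_vectorspace \<eta>_hom IJ)
  let ?P = "{x \<in> carrier (sum_space I (obj M)). ?f x \<in> colimit_rel K N J}"
  have P: "VectorSpace.subspace K ?P (sum_space I (obj M))"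
    by (rule vector_subspace_preimage[OF M.vectorspace_sum_obj f.f_hom N.colimit_rel_subspace])
  have "colimit_gens M I \<subseteq> ?P"
  proof clarify
    fix p q v assume pq: "p \<in> I" "q \<in> I" "p \<le> q" and v: "v \<in> carrier (obj M p)"
    let ?a = "sum_inj I (obj M) q (mor M p q v)" and ?b = "sum_inj I (obj M) p v"
    have ab: "?a \<in> carrier (sum_space I (obj M))" "?b \<in> carrier (sum_space I (obj M))"
      using pq v M.mor_closed by (auto intro!: M.sum_inj_closed)
    have inj: "?f (sum_inj I (obj M) r w) = sum_inj J (obj N) r (\<eta> r w)" if "r \<in> I" for r w
      by (rule sum_map_sum_inj[OF M.obj_vectorspace N.obj_vectorspace \<eta>_hom IJ that])
    have "?f (?a \<ominus>\<^bsub>sum_space I (obj M)\<^esub> ?b) =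
      sum_inj J (obj N) q (\<eta> q (mor M p q v)) \<ominus>\<^bsub>sum_space J (obj N)\<^esub> sum_inj J (obj N) p (\<eta> p v)"
      using f.f_minus[OF ab] inj pq by simp
    also have "\<eta> q (mor M p q v) = mor N p q (\<eta> p v)"
      using \<eta> pq v by (simp add: pmod_hom_def)
    also have "sum_inj J (obj N) q (mor N p q (\<eta> p v)) \<ominus>\<^bsub>sum_space J (obj N)\<^esub> sum_inj J (obj N) p (\<eta> p v)
        \<in> colimit_gens N J"
      using pq IJ module_homD(1)[OF \<eta>_hom v] by blast
    also have "\<dots> \<subseteq> colimit_rel K N J"
      unfolding colimit_rel_def by (rule T.in_own_span[OF N.colimit_gens_closed])
    finally show "?a \<ominus>\<^bsub>sum_space I (obj M)\<^esub> ?b \<in> carrier (sum_space I (obj M)) \<and>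
        ?f (?a \<ominus>\<^bsub>sum_space I (obj M)\<^esub> ?b) \<in> colimit_rel K N J"
      using S.M.minus_closed[OF ab] by blast
  qed
  then have "colimit_rel K M I \<subseteq> ?P"
    unfolding colimit_rel_def[of K M I] by (rule S.span_is_subset[OF _ S.is_module[OF P]])
  then show ?thesis using x by blast
qed

text \<open>
  A section over \<open>J\<close> restricts to a section over \<open>I\<close>, and elements identified in the colimit
  over \<open>I\<close> are identified in the colimit over \<open>J\<close>. Hence, at a point \<open>p \<in> I\<close>, the
  values \<open>A\<close> of sections over \<open>J\<close> form a subspace of the values \<open>E\<close> of sections over
  \<open>I\<close>, and the map \<open>?g\<close> to the colimit over \<open>J\<close> kills the kernel of the map \<open>?f\<close> to the
  colimit over \<open>I\<close>.
\<close>
lemma gen_rank_antimono_iso: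
  assumes M: "persistence_module K M" and N: "persistence_module K N" and iso: "pmod_iso K M N"
    and I: "I \<noteq> {}" "poset_connected I" and J: "poset_connected J" and IJ: "I \<subseteq> J"
  shows "gen_rank K N J \<le> gen_rank K M I"
proof -
  interpret M: persistence_module K M by fact
  interpret N: persistence_module K N by fact
  obtain \<eta> where \<eta>: "\<eta> \<in> pmod_hom K M N"
    and bij: "\<And>p. bij_betw (\<eta> p) (carrier (obj M p)) (carrier (obj N p))"
    using iso by (auto simp: pmod_iso_def)
  have \<eta>_hom: "\<eta> p \<in> module_hom K (obj M p) (obj N p)" for p
    using \<eta> by (simp add: pmod_hom_def)
  have \<eta>_inj: "x = y"
    if "x \<in> carrier (obj M p)" "y \<in> carrier (obj M p)" "\<eta> p x = \<eta> p y" for p x y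
    using bij_betw_imp_inj_on[OF bij] that by (auto dest: inj_onD)
  obtain p where p: "p \<in> I" using I by blast
  then have pJ: "p \<in> J" using IJ by blast
  define E where "E = (\<lambda>s. s p) ` carrier (limit_space M I)"
  define F where "F = (\<lambda>s. s p) ` carrier (limit_space N J)"
  define A where "A = {x \<in> carrier (obj M p). \<eta> p x \<in> F}"
  have E: "VectorSpace.subspace K E (obj M p)"
    unfolding E_def by (rule M.limit_values_subspace[OF p])
  have F: "VectorSpace.subspace K F (obj N p)"
    unfolding F_def by (rule N.limit_values_subspace[OF pJ])
  have A: "VectorSpace.subspace K A (obj M p)"
    unfolding A_def by (rule vector_subspace_preimage[OF M.obj_vectorspace \<eta>_hom F])
  have AE: "A \<subseteq> E"
  proof
    fix x assume "x \<in> A"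
    then obtain s where x: "x \<in> carrier (obj M p)" and s: "s \<in> carrier (limit_space N J)"
      and xs: "\<eta> p x = s p" by (auto simp: A_def F_def)
    have s_obj: "s q \<in> carrier (obj N q)" if "q \<in> I" for q
      using s that IJ by (auto simp: limit_space_def prod_space_simps PiE_iff)
    \<comment> \<open>the restriction of \<open>s\<close> to \<open>I\<close>, transported back along \<open>\<eta>\<close>\<close>
    define t where "t = (\<lambda>q\<in>I. the_inv_into (carrier (obj M q)) (\<eta> q) (s q))"
    have t: "t q \<in> carrier (obj M q)" "\<eta> q (t q) = s q" if "q \<in> I" for q
      using that s_obj[OF that] bij[of q] f_the_inv_into_f_bij_betw[OF bij[of q]]
        the_inv_into_into[of "\<eta> q" "carrier (obj M q)" "s q"]
      by (auto simp: t_def bij_betw_def)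
    have "mor M q r (t q) = t r" if qr: "q \<in> I" "r \<in> I" "q \<le> r" for q r
    proof -
      have "\<eta> r (mor M q r (t q)) = mor N q r (\<eta> q (t q))"
        using \<eta> qr t by (simp add: pmod_hom_def)
      also have "\<dots> = \<eta> r (t r)"
        using s qr t subsetD[OF IJ] by (simp add: limit_space_def)
      finally show ?thesis
        by (rule \<eta>_inj[OF M.mor_closed[OF qr(3) t(1)[OF qr(1)]] t(1)[OF qr(2)]])
    qed
    then have "t \<in> carrier (limit_space M I)"
      using t by (auto simp: limit_space_def prod_space_simps t_def)
    moreover have "x = t p"
      by (rule \<eta>_inj[OF x t(1)[OF p]]) (simp add: t(2)[OF p] xs)
    ultimately show "x \<in> E" by (auto simp: E_def)
  qed
  let ?f = "colimit_inj K M I p" and ?g = "\<lambda>x. colimit_inj K N J p (\<eta> p x)"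
  have g: "?g \<in> module_hom K (obj M p) (colimit_space K N J)"
    by (rule module_hom_comp[OF \<eta>_hom N.colimit_inj_module_hom[OF pJ]])
  have ker: "?g x = \<zero>\<^bsub>colimit_space K N J\<^esub>"
    if x: "x \<in> carrier (obj M p)" and fx: "?f x = \<zero>\<^bsub>colimit_space K M I\<^esub>" for x
  proof -
    have "sum_map I J (obj N) \<eta> (sum_inj I (obj M) p x) \<in> colimit_rel K N J"
      using M.colimit_inj_eq_zero_iff[OF p x] fx
      by (intro colimit_rel_sum_map[OF M N \<eta> IJ]) simp
    then have "sum_inj J (obj N) p (\<eta> p x) \<in> colimit_rel K N J"
      using sum_map_sum_inj[where V = "obj M" and W = "obj N" and \<phi> = \<eta>,
          OF M.obj_vectorspace N.obj_vectorspace \<eta>_hom IJ p] by simp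
    then show ?thesis
      using N.colimit_inj_eq_zero_iff[OF pJ module_homD(1)[OF \<eta>_hom x]] by simp
  qed
  have "F \<subseteq> \<eta> p ` A"
    using vector_subspaceD(2)[OF F] bij[of p] by (auto simp: A_def bij_betw_def)
  then have "colimit_inj K N J p ` F = ?g ` A"
    by (auto simp: A_def)
  then have "gen_rank K N J = vectorspace.dim K ((colimit_space K N J)\<lparr>carrier := ?g ` A\<rparr>)"
    using N.gen_rank_eq[OF J pJ] by (simp add: F_def)
  also have "\<dots> \<le> vectorspace.dim K ((colimit_space K M I)\<lparr>carrier := ?f ` E\<rparr>)"
    by (rule dim_image_subspace_le[OF E M.obj_fin_dim A AE M.vectorspace_colimit_space
          M.colimit_inj_module_hom[OF p] N.vectorspace_colimit_space g ker])
  also have "\<dots> = gen_rank K M I"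
    using M.gen_rank_eq[OF I(2) p] by (simp add: E_def)
  finally show ?thesis .
qed

lemma pmod_iso_refl: "pmod_iso K M M"
  unfolding pmod_iso_def pmod_hom_def
  by (intro bexI[of _ "\<lambda>p x. x"]) (auto simp: module_hom_def bij_betw_def)

lemma pmod_iso_sym:
  assumes M: "persistence_module K M" and iso: "pmod_iso K M N"
  shows "pmod_iso K N M"
proof -
  interpret M: persistence_module K M by fact
  obtain \<eta> where \<eta>: "\<eta> \<in> pmod_hom K M N"
    and bij: "\<And>p. bij_betw (\<eta> p) (carrier (obj M p)) (carrier (obj N p))"
    using iso by (auto simp: pmod_iso_def)
  have \<eta>_hom: "\<eta> p \<in> module_hom K (obj M p) (obj N p)" for p
    using \<eta> by (simp add: pmod_hom_def)
  define \<theta> where "\<theta> p = the_inv_into (carrier (obj M p)) (\<eta> p)" for p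
  have \<theta>_bij: "bij_betw (\<theta> p) (carrier (obj N p)) (carrier (obj M p))" for p
    unfolding \<theta>_def by (rule bij_betw_the_inv_into[OF bij])
  have \<theta>: "\<theta> p y \<in> carrier (obj M p)" "\<eta> p (\<theta> p y) = y" if "y \<in> carrier (obj N p)" for p y
    using bij_betwE[OF \<theta>_bij] f_the_inv_into_f_bij_betw[OF bij] that by (auto simp: \<theta>_def)
  have \<theta>_eq: "\<theta> p y = x" if "x \<in> carrier (obj M p)" "\<eta> p x = y" for p x y
    using bij[of p] that the_inv_into_f_f[of "\<eta> p"] by (auto simp: \<theta>_def bij_betw_def)
  have "\<theta> p \<in> module_hom K (obj N p) (obj M p)" for p
  proof -
    interpret Mp: vectorspace K "obj M p" by (rule M.obj_vectorspace)
    show ?thesis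
      using \<theta> module_homD[OF \<eta>_hom[of p]] by (intro module_homI \<theta>_eq) auto
  qed
  moreover have "\<theta> q (mor N p q y) = mor M p q (\<theta> p y)"
    if "p \<le> q" "y \<in> carrier (obj N p)" for p q y
    using that \<theta>[OF that(2)] M.mor_closed \<eta> by (intro \<theta>_eq) (auto simp: pmod_hom_def)
  ultimately have "\<theta> \<in> pmod_hom K N M"
    by (simp add: pmod_hom_def)
  then show ?thesis using \<theta>_bij by (auto simp: pmod_iso_def)
qed

lemma gen_rank_antimono:
  assumes "persistence_module K M" "I \<noteq> {}" "poset_connected I" "poset_connected J" "I \<subseteq> J"
  shows "gen_rank K M J \<le> gen_rank K M I"
  using gen_rank_antimono_iso[OF assms(1,1) pmod_iso_refl assms(2-5)] .

lemma gen_rank_pmod_iso: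
  assumes "persistence_module K M" "persistence_module K N" "pmod_iso K M N"
    and "I \<noteq> {}" "poset_connected I"
  shows "gen_rank K M I = gen_rank K N I"
  using gen_rank_antimono_iso[OF assms(1,2,3,4,5,5) order_refl]
    gen_rank_antimono_iso[OF assms(2,1) pmod_iso_sym[OF assms(1,3)] assms(4,5,5) order_refl]
  by simp

section \<open>Uniqueness of the generalized persistence diagram\<close>

text \<open>
  If two diagrams differed, there would be a maximal interval \<open>J\<close> where they do, since only
  finitely many intervals above a given one carry a nonzero value. At \<open>J\<close> the two sums of values
  over larger intervals agree, and so do all their other terms.
\<close>
lemma is_gpd_unique:
  assumes D: "is_gpd K M \<I> D" and E: "is_gpd K M \<I> E"
  shows "D = E"
proof (rule ccontr)
  assume ne: "D \<noteq> E"
  have DE: "D \<in> \<I> \<rightarrow>\<^sub>E UNIV" "E \<in> \<I> \<rightarrow>\<^sub>E UNIV"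
    using D E by (simp_all add: is_gpd_def)
  obtain I where I: "I \<in> \<I>" "D I \<noteq> E I"
    using ne PiE_ext[OF DE] by blast
  have finD: "finite {J\<in>\<I>. J' \<subseteq> J \<and> D J \<noteq> 0}" and finE: "finite {J\<in>\<I>. J' \<subseteq> J \<and> E J \<noteq> 0}"
    if "J' \<in> \<I>" for J'
    using D E that by (simp_all add: is_gpd_def)
  let ?S = "{J\<in>\<I>. I \<subseteq> J \<and> D J \<noteq> E J}"
  have "finite ?S"
    by (rule finite_subset[OF _ finite_UnI[OF finD[OF I(1)] finE[OF I(1)]]]) auto
  then obtain J where J: "J \<in> ?S" and max: "\<And>J'. J' \<in> ?S \<Longrightarrow> J \<subseteq> J' \<Longrightarrow> J = J'"
  proof -
    have "?S \<noteq> {}" using I by auto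
    then show thesis using finite_has_maximal[OF \<open>finite ?S\<close>] that by blast
  qed
  let ?T = "{J'\<in>\<I>. J \<subseteq> J' \<and> D J' \<noteq> 0} \<union> {J'\<in>\<I>. J \<subseteq> J' \<and> E J' \<noteq> 0}"
  have JI: "J \<in> \<I>" using J by simp
  have T: "finite ?T" using finD[OF JI] finE[OF JI] by simp
  have "(\<Sum>J'\<in>?T. D J') = int (gen_rank K M J)"
    using D JI T by (auto simp: is_gpd_def intro!: sum.mono_neutral_right)
  also have "\<dots> = (\<Sum>J'\<in>?T. E J')"
    using E JI T by (auto simp: is_gpd_def intro!: sum.mono_neutral_left)
  finally have eq: "(\<Sum>J'\<in>?T. D J') = (\<Sum>J'\<in>?T. E J')" .
  have JT: "J \<in> ?T" using J by auto
  have "D J' = E J'" if "J' \<in> ?T - {J}" for J'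
    using max[of J'] that J by auto
  then have "sum D (?T - {J}) = sum E (?T - {J})" by (rule sum.cong[OF refl])
  then have "D J = E J"
    using eq unfolding sum.remove[OF T JT, of D] sum.remove[OF T JT, of E] by simp
  then show False using J by simp
qed

lemma is_gpd_gpd: "has_gpd K M \<I> \<Longrightarrow> is_gpd K M \<I> (gpd K M \<I>)"
proof -
  assume "has_gpd K M \<I>"
  then obtain D where D: "is_gpd K M \<I> D" by (auto simp: has_gpd_def)
  then have "gpd K M \<I> = D"
    unfolding gpd_def by (intro the_equality is_gpd_unique)
  then show ?thesis using D by simp
qed

lemma gen_rank_eq_of_gpd_eq:
  assumes "has_gpd K M \<I>" "has_gpd K N \<I>" "gpd K M \<I> = gpd K N \<I>" "I \<in> \<I>"
  shows "gen_rank K M I = gen_rank K N I"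
proof -
  have "int (gen_rank K M I) = int (gen_rank K N I)"
    using assms is_gpd_gpd[of K M \<I>] is_gpd_gpd[of K N \<I>] by (simp add: is_gpd_def)
  then show ?thesis by simp
qed

section \<open>Thickenings\<close>

lemma infnorm_le_iff: "infnorm (x::real^'d) \<le> \<epsilon> \<longleftrightarrow> (\<forall>i. \<bar>x $ i\<bar> \<le> \<epsilon>)"
proof
  show "\<forall>i. \<bar>x $ i\<bar> \<le> \<epsilon> \<Longrightarrow> infnorm x \<le> \<epsilon>"
    unfolding infnorm_cart by (rule cSup_least) auto
qed (use component_le_infnorm_cart order_trans in blast)

text \<open>In the supremum norm the thickening is the Minkowski sum with a cube.\<close>
lemma thickening_iff:
  "q \<in> thickening \<epsilon> I \<longleftrightarrow> (\<exists>p\<in>I. \<forall>i. p $ i - \<epsilon> \<le> q $ i \<and> q $ i \<le> p $ i + \<epsilon>)"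
proof -
  have "infnorm (p - q) \<le> \<epsilon> \<longleftrightarrow> (\<forall>i. p $ i - \<epsilon> \<le> q $ i \<and> q $ i \<le> p $ i + \<epsilon>)" for p
    unfolding infnorm_le_iff by (intro all_cong1) (auto simp: abs_le_iff)
  then show ?thesis by (simp add: thickening_def)
qed

lemma subset_thickening: "0 \<le> \<epsilon> \<Longrightarrow> I \<subseteq> thickening \<epsilon> I"
  unfolding subset_iff thickening_iff by (intro allI impI, rule bexI) auto

lemma thickening_mono: "I \<subseteq> J \<Longrightarrow> thickening \<epsilon> I \<subseteq> thickening \<epsilon> J"
  by (auto simp: thickening_def)

lemma thickening_thickening:
  assumes "0 \<le> \<delta>" "0 \<le> \<epsilon>"
  shows "thickening \<delta> (thickening \<epsilon> I) = thickening (\<epsilon> + \<delta>) I"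
proof
  show "thickening \<delta> (thickening \<epsilon> I) \<subseteq> thickening (\<epsilon> + \<delta>) I"
  proof
    fix r assume "r \<in> thickening \<delta> (thickening \<epsilon> I)"
    then obtain q p where "p \<in> I"
      "\<forall>i. p $ i - \<epsilon> \<le> q $ i \<and> q $ i \<le> p $ i + \<epsilon>" "\<forall>i. q $ i - \<delta> \<le> r $ i \<and> r $ i \<le> q $ i + \<delta>"
      by (auto simp: thickening_iff)
    then show "r \<in> thickening (\<epsilon> + \<delta>) I"
      unfolding thickening_iff by (intro bexI[of _ p] allI) (auto simp: algebra_simps intro: order_trans dest!: spec)
  qed
  show "thickening (\<epsilon> + \<delta>) I \<subseteq> thickening \<delta> (thickening \<epsilon> I)"
  proof
    fix r assume "r \<in> thickening (\<epsilon> + \<delta>) I"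
    then obtain p where p: "p \<in> I" "\<And>i. p $ i - (\<epsilon> + \<delta>) \<le> r $ i" "\<And>i. r $ i \<le> p $ i + (\<epsilon> + \<delta>)"
      by (auto simp: thickening_iff)
    \<comment> \<open>the point of the \<open>\<epsilon>\<close>-cube around \<open>p\<close> that is closest to \<open>r\<close>\<close>
    define q where "q = (\<chi> i. max (p $ i - \<epsilon>) (min (p $ i + \<epsilon>) (r $ i)))"
    have "p $ i - \<epsilon> \<le> q $ i \<and> q $ i \<le> p $ i + \<epsilon>" for i
      using assms by (auto simp: q_def)
    then have "q \<in> thickening \<epsilon> I"
      using p(1) unfolding thickening_iff by blast
    moreover have "q $ i - \<delta> \<le> r $ i \<and> r $ i \<le> q $ i + \<delta>" for i
      using assms p(2,3)[of i] by (auto simp: q_def max_def min_def)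
    ultimately show "r \<in> thickening \<delta> (thickening \<epsilon> I)"
      unfolding thickening_iff[where I = "thickening \<epsilon> I"] by blast
  qed
qed

text \<open>
  Each point of the \<open>\<epsilon>\<close>-cube around \<open>p\<close> lies below its top corner, and so does \<open>p\<close>.
\<close>
lemma poset_connected_thickening:
  fixes I :: "(real^'d) set"
  assumes I: "poset_connected I" and \<epsilon>: "0 \<le> \<epsilon>"
  shows "poset_connected (thickening \<epsilon> I)"
proof -
  let ?T = "thickening \<epsilon> I"
  let ?R = "\<lambda>I::(real^'d) set. {(a, b). a \<in> I \<and> b \<in> I \<and> (a \<le> b \<or> b \<le> a)}"
  have sym: "sym ((?R ?T)\<^sup>*)"
    by (intro sym_rtrancl) (auto simp: sym_def)
  have near: "\<exists>p\<in>I. (p, q) \<in> (?R ?T)\<^sup>*" if q: "q \<in> ?T" for q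
  proof -
    obtain p where p: "p \<in> I" "\<And>i. p $ i - \<epsilon> \<le> q $ i" "\<And>i. q $ i \<le> p $ i + \<epsilon>"
      using q unfolding thickening_iff by blast
    define u where "u = (\<chi> i. p $ i + \<epsilon>)"
    have "u \<in> ?T" using p(1) \<epsilon> by (force simp: thickening_iff u_def)
    moreover have "p \<in> ?T" using p(1) subset_thickening[OF \<epsilon>] by blast
    moreover have "p \<le> u" "q \<le> u" using p \<epsilon> by (auto simp: less_eq_vec_def u_def)
    ultimately have "(p, u) \<in> ?R ?T" "(u, q) \<in> ?R ?T" using q by auto
    then show ?thesis using p(1) by (meson rtrancl.rtrancl_into_rtrancl r_into_rtrancl)
  qed
  have "?R I \<subseteq> ?R ?T" using subset_thickening[OF \<epsilon>, of I] by auto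
  then have mono: "(?R I)\<^sup>* \<subseteq> (?R ?T)\<^sup>*" by (rule rtrancl_mono)
  show ?thesis
    unfolding poset_connected_def
  proof (intro ballI)
    fix a b assume "a \<in> ?T" "b \<in> ?T"
    then obtain p q where pq: "p \<in> I" "q \<in> I" "(p, a) \<in> (?R ?T)\<^sup>*" "(q, b) \<in> (?R ?T)\<^sup>*"
      using near by meson
    have "(p, q) \<in> (?R ?T)\<^sup>*"
      using I pq(1,2) mono by (auto simp: poset_connected_def)
    then show "(a, b) \<in> (?R ?T)\<^sup>*"
      using symD[OF sym pq(3)] pq(4) by (meson rtrancl_trans)
  qed
qed

text \<open>
  Suppose that \<open>I\<close> avoids the box. By convexity no comparable pair \<open>x \<le> y\<close> in \<open>I\<close> has
  \<open>x \<le> u\<close> and \<open>l \<le> y\<close>, because the segment between them would meet the box. Applied to \<open>p\<close>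
  and \<open>q\<close> this shows that \<open>p\<close> lies beneath the box and \<open>q\<close> over it in one coordinate
  direction \<open>j\<close>, whereas \<open>q\<close> precedes \<open>p\<close> in the other direction \<open>i\<close>. It also shows that
  no point \<open>x\<close> of \<open>I\<close> lies in the quadrants \<open>x $ i \<ge> p $ i, x $ j \<ge> l $ j\<close> and
  \<open>x $ i \<le> q $ i, x $ j \<le> u $ j\<close>. The gap between these quadrants at the height of the box lies
  inside the box, and no comparable pair can jump over it, so a zigzag from \<open>p\<close> cannot leave
  the half plane below \<open>l $ j\<close>.
\<close>
lemma interval_meets_box:
  fixes I :: "(real^'d) set"
  assumes d: "CARD('d) \<le> 2" and I: "poset_convex I" "poset_connected I"
    and lu: "l \<le> u" and p: "p \<in> I" "p \<le> u" and q: "q \<in> I" "l \<le> q"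
  shows "\<exists>x\<in>I. l \<le> x \<and> x \<le> u"
proof (rule ccontr)
  assume "\<not> ?thesis"
  then have box: "\<And>x. x \<in> I \<Longrightarrow> l \<le> x \<Longrightarrow> x \<le> u \<Longrightarrow> False" by blast
  have sep: False if "x \<in> I" "y \<in> I" "x \<le> u" "l \<le> y" "x \<le> y" for x y
  proof -
    \<comment> \<open>the join of \<open>x\<close> and \<open>l\<close>, a point both of the segment and of the box\<close>
    define z where "z = (\<chi> i. max (x $ i) (l $ i))"
    have "x \<le> z" "z \<le> y" "l \<le> z" "z \<le> u"
      using that lu by (auto simp: z_def less_eq_vec_def)
    then show False
      using I(1) that box[of z] unfolding poset_convex_def by blast
  qed
  obtain i where i: "q $ i < p $ i"
    using sep[OF p(1) q(1) p(2) q(2)] unfolding less_eq_vec_def by (meson not_le)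
  have li: "l $ i \<le> q $ i" and pi: "p $ i \<le> u $ i"
    using q p by (auto simp: less_eq_vec_def)
  obtain j where j: "p $ j < l $ j"
    using box[OF p(1) _ p(2)] unfolding less_eq_vec_def[of l] by (meson not_le)
  have lj: "l $ j \<le> q $ j" and pj: "p $ j \<le> u $ j"
    using q p by (auto simp: less_eq_vec_def)
  have ij: "i \<noteq> j" using i li j by auto
  have UNIV_ij: "k = i \<or> k = j" for k
  proof (rule ccontr)
    assume "\<not> (k = i \<or> k = j)"
    then have "card {i, j, k} = 3" using ij by auto
    moreover have "card {i, j, k} \<le> CARD('d)" by (rule card_mono) auto
    ultimately show False using d by simp
  qed
  have le_iff: "x \<le> y \<longleftrightarrow> x $ i \<le> y $ i \<and> x $ j \<le> y $ j" for x y :: "real^'d"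
  proof
    assume *: "x $ i \<le> y $ i \<and> x $ j \<le> y $ j"
    show "x \<le> y"
      unfolding less_eq_vec_def
    proof
      fix k show "x $ k \<le> y $ k" using UNIV_ij[of k] * by (elim disjE) simp_all
    qed
  qed (simp add: less_eq_vec_def)
  have qj: "u $ j < q $ j"
  proof (rule ccontr)
    assume "\<not> u $ j < q $ j"
    then have "q \<le> u" using i pi by (simp add: le_iff)
    then show False using box[OF q] by simp
  qed
  have above: "x $ i < p $ i" if "x \<in> I" "l $ j \<le> x $ j" for x
  proof (rule ccontr)
    assume "\<not> x $ i < p $ i"
    then have "p \<le> x" "l \<le> x" using that i li j by (simp_all add: le_iff)
    then show False using sep[OF p(1) that(1) p(2)] by simp
  qed
  have below: "q $ i < x $ i" if "x \<in> I" "x $ j \<le> u $ j" for x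
  proof (rule ccontr)
    assume "\<not> q $ i < x $ i"
    then have "x \<le> q" "x \<le> u" using that i pi qj by (simp_all add: le_iff)
    then show False using sep[OF that(1) q(1) _ q(2)] by simp
  qed
  have luj: "l $ j \<le> u $ j" using lu by (simp add: less_eq_vec_def)
  have "x $ j < l $ j" if "(p, x) \<in> {(a, b). a \<in> I \<and> b \<in> I \<and> (a \<le> b \<or> b \<le> a)}\<^sup>*" for x
    using that
  proof (induction rule: rtrancl_induct)
    case base
    show ?case by (rule j)
  next
    case (step x y)
    have xy: "x \<in> I" "y \<in> I" "x \<le> y \<or> y \<le> x" using step.hyps(2) by auto
    have xi: "q $ i < x $ i" using below[OF xy(1)] step.IH luj by simp
    show ?case
    proof (rule ccontr)
      assume yj: "\<not> y $ j < l $ j"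
      then have yi: "y $ i < p $ i" using above[OF xy(2)] by simp
      have le: "x \<le> y" using xy(3) yj step.IH by (auto simp: le_iff)
      then have "x $ i \<le> y $ i" by (simp add: le_iff)
      then have "x \<le> u" "l \<le> y" using xi yi yj step.IH li pi luj by (simp_all add: le_iff)
      then show False using sep[OF xy(1,2) _ _ le] by simp
    qed
  qed
  then have "q $ j < l $ j"
    using I(2) p(1) q(1) by (simp add: poset_connected_def)
  then show False using lj by simp
qed

text \<open>
  A point \<open>r\<close> lies in the thickening iff the cube of radius \<open>\<epsilon>\<close> around it meets \<open>I\<close>; if
  \<open>a \<le> r \<le> b\<close>, points of \<open>I\<close> close to \<open>a\<close> and \<open>b\<close> lie below the top corner and above
  the bottom corner of this cube.
\<close>
lemma thickening_interval:
  fixes I :: "(real^'d) set"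
  assumes d: "CARD('d) \<le> 2" and I: "I \<in> intervals" and \<epsilon>: "0 \<le> \<epsilon>"
  shows "thickening \<epsilon> I \<in> intervals"
proof -
  have I': "I \<noteq> {}" "poset_convex I" "poset_connected I"
    using I by (auto simp: intervals_def)
  have "poset_convex (thickening \<epsilon> I)"
    unfolding poset_convex_def
  proof (intro ballI allI impI)
    fix a b r assume a: "a \<in> thickening \<epsilon> I" and b: "b \<in> thickening \<epsilon> I" and r: "a \<le> r \<and> r \<le> b"
    obtain p where p: "p \<in> I" "\<And>i. p $ i - \<epsilon> \<le> a $ i" using a by (auto simp: thickening_iff)
    obtain q where q: "q \<in> I" "\<And>i. b $ i \<le> q $ i + \<epsilon>" using b by (auto simp: thickening_iff)
    have "\<exists>x\<in>I. (\<chi> i. r $ i - \<epsilon>) \<le> x \<and> x \<le> (\<chi> i. r $ i + \<epsilon>)"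
    proof (rule interval_meets_box[OF d I'(2,3) _ p(1) _ q(1)])
      show "(\<chi> i. r $ i - \<epsilon>) \<le> (\<chi> i. r $ i + \<epsilon>)" using \<epsilon> by (simp add: less_eq_vec_def)
      show "p \<le> (\<chi> i. r $ i + \<epsilon>)"
        using p(2) r by (simp add: less_eq_vec_def) (smt (verit))
      show "(\<chi> i. r $ i - \<epsilon>) \<le> q"
        using q(2) r by (simp add: less_eq_vec_def) (smt (verit))
    qed
    then show "r \<in> thickening \<epsilon> I"
      by (force simp: thickening_iff less_eq_vec_def algebra_simps)
  qed
  then show ?thesis
    using I' subset_thickening[OF \<epsilon>] poset_connected_thickening[OF I'(3) \<epsilon>]
    by (auto simp: intervals_def)
qed

section \<open>Comparison of the distances\<close>

lemma dhat_le_sparse_erosion_dist: "dhat \<I> \<J> \<le> sparse_erosion_dist K M \<I> N \<J>"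
  unfolding dhat_def sparse_erosion_dist_def by (rule INF_superset_mono) auto

text \<open>The diagonal of \<open>\<I>\<close> serves as the correspondence.\<close>
lemma sparse_erosion_dist_le_erosion_dist:
  assumes "closed_under_thickening \<I>"
  shows "sparse_erosion_dist K M \<I> N \<I> \<le> erosion_dist K \<I> M N"
  unfolding erosion_dist_def sparse_erosion_dist_def
proof (rule INF_superset_mono[OF _ order_refl], rule subsetI)
  fix \<epsilon> assume "\<epsilon> \<in> {\<epsilon>. \<epsilon> > 0 \<and> (\<forall>I\<in>\<I>.
        gen_rank K N (thickening \<epsilon> I) \<le> gen_rank K M I \<and>
        gen_rank K M (thickening \<epsilon> I) \<le> gen_rank K N I)}"
  then have \<epsilon>: "\<epsilon> > 0" and rk: "\<And>I. I \<in> \<I> \<Longrightarrow> gen_rank K N (thickening \<epsilon> I) \<le> gen_rank K M I"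
      "\<And>I. I \<in> \<I> \<Longrightarrow> gen_rank K M (thickening \<epsilon> I) \<le> gen_rank K N I"
    by auto
  let ?R = "(\<lambda>I. (I, I)) ` \<I>"
  have "eps_correspondence \<epsilon> \<I> \<I> ?R"
    using subset_thickening[of \<epsilon>] \<epsilon>
    by (auto simp: eps_correspondence_def correspondence_def image_image)
  moreover have "gen_rank K N (thickening (\<epsilon> + \<delta>) I) \<le> gen_rank K M (thickening \<delta> I) \<and>
      gen_rank K M (thickening (\<epsilon> + \<delta>) I) \<le> gen_rank K N (thickening \<delta> I)"
    if I: "I \<in> \<I>" and \<delta>: "\<delta> \<ge> 0" for I \<delta>
  proof -
    have "thickening \<delta> I \<in> \<I>"
      using assms I \<delta> by (simp add: closed_under_thickening_def)
    moreover have "thickening (\<epsilon> + \<delta>) I = thickening \<epsilon> (thickening \<delta> I)"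
      using thickening_thickening[of \<epsilon> \<delta> I] \<epsilon> \<delta> by (simp add: add.commute)
    ultimately show ?thesis
      using rk by simp
  qed
  ultimately show "\<epsilon> \<in> {\<epsilon>. \<epsilon> > 0 \<and> (\<exists>R. eps_correspondence \<epsilon> \<I> \<I> R \<and>
        (\<forall>(I, J)\<in>R. \<forall>\<delta>\<ge>0.
          gen_rank K N (thickening (\<epsilon> + \<delta>) J) \<le> gen_rank K M (thickening \<delta> I) \<and>
          gen_rank K M (thickening (\<epsilon> + \<delta>) I) \<le> gen_rank K N (thickening \<delta> J)))}"
    using \<epsilon> by (intro CollectI conjI exI[of _ ?R]) auto
qed

lemma gen_rank_thickening_le:
  assumes M: "persistence_module K M" and I: "I \<in> intervals" and J: "J \<in> intervals"
    and IJ: "I \<subseteq> thickening \<epsilon> J" and \<epsilon>: "\<epsilon> \<ge> 0" and \<delta>: "\<delta> \<ge> 0"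
  shows "gen_rank K M (thickening (\<epsilon> + \<delta>) J) \<le> gen_rank K M (thickening \<delta> I)"
proof (rule gen_rank_antimono[OF M])
  show "thickening \<delta> I \<noteq> {}"
    using I subset_thickening[OF \<delta>, of I] by (auto simp: intervals_def)
  show "poset_connected (thickening \<delta> I)" "poset_connected (thickening (\<epsilon> + \<delta>) J)"
    using I J \<epsilon> \<delta> by (auto simp: intervals_def intro!: poset_connected_thickening)
  show "thickening \<delta> I \<subseteq> thickening (\<epsilon> + \<delta>) J"
    using thickening_mono[OF IJ, of \<delta>] thickening_thickening[OF \<delta> \<epsilon>, of J] by simp
qed

text \<open>
  Every \<open>\<epsilon>\<close>-correspondence is admissible: by the equality of ranks both conditions concern a
  single module, where they follow from monotonicity.
\<close>
lemma sparse_erosion_dist_le_dhat: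
  assumes M: "persistence_module K M" and N: "persistence_module K N"
    and \<I>: "\<I> \<subseteq> intervals" and \<J>: "\<J> \<subseteq> intervals"
    and rk: "\<And>I \<epsilon>. I \<in> \<I> \<union> \<J> \<Longrightarrow> \<epsilon> \<ge> 0 \<Longrightarrow>
      gen_rank K M (thickening \<epsilon> I) = gen_rank K N (thickening \<epsilon> I)"
  shows "sparse_erosion_dist K M \<I> N \<J> \<le> dhat \<I> \<J>"
  unfolding dhat_def sparse_erosion_dist_def
proof (rule INF_superset_mono[OF _ order_refl], rule subsetI)
  fix \<epsilon> assume "\<epsilon> \<in> {\<epsilon>. \<epsilon> > 0 \<and> (\<exists>R. eps_correspondence \<epsilon> \<I> \<J> R)}"
  then obtain R where \<epsilon>: "\<epsilon> > 0" and R: "eps_correspondence \<epsilon> \<I> \<J> R" by auto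
  have "gen_rank K N (thickening (\<epsilon> + \<delta>) J) \<le> gen_rank K M (thickening \<delta> I) \<and>
      gen_rank K M (thickening (\<epsilon> + \<delta>) I) \<le> gen_rank K N (thickening \<delta> J)"
    if IJ: "(I, J) \<in> R" and \<delta>: "\<delta> \<ge> 0" for I J \<delta>
  proof -
    have "I \<in> \<I>" "J \<in> \<J>"
      using R IJ by (auto simp: eps_correspondence_def correspondence_def)
    then have "I \<in> \<I> \<union> \<J>" "J \<in> \<I> \<union> \<J>" "I \<in> intervals" "J \<in> intervals"
      using \<I> \<J> by auto
    moreover have "I \<subseteq> thickening \<epsilon> J" "J \<subseteq> thickening \<epsilon> I"
      using R IJ by (auto simp: eps_correspondence_def)
    ultimately show ?thesis
      using gen_rank_thickening_le[OF M, of I J \<epsilon> \<delta>] gen_rank_thickening_le[OF M, of J I \<epsilon> \<delta>]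
        rk[of J "\<epsilon> + \<delta>"] rk[of J \<delta>] \<epsilon> \<delta> by simp
  qed
  then show "\<epsilon> \<in> {\<epsilon>. \<epsilon> > 0 \<and> (\<exists>R. eps_correspondence \<epsilon> \<I> \<J> R \<and>
        (\<forall>(I, J)\<in>R. \<forall>\<delta>\<ge>0.
          gen_rank K N (thickening (\<epsilon> + \<delta>) J) \<le> gen_rank K M (thickening \<delta> I) \<and>
          gen_rank K M (thickening (\<epsilon> + \<delta>) I) \<le> gen_rank K N (thickening \<delta> J)))}"
    using \<epsilon> R by (intro CollectI conjI exI[of _ R]) auto
qed

theorem proposition6:
  fixes K :: "'k ring"
    and M :: "(real^'d, 'k, 'v) pmod"
    and N :: "(real^'d, 'k, 'w) pmod"
    and \<I> \<J> :: "(real^'d) set set"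
  assumes "field K"
    and "persistence_module K M" and "finitely_presentable K M"
    and "persistence_module K N" and "finitely_presentable K N"
    and "\<I> \<subseteq> intervals" and "\<I> \<noteq> {}"
    and "\<J> \<subseteq> intervals" and "\<J> \<noteq> {}"
  shows "dhat \<I> \<J> \<le> sparse_erosion_dist K M \<I> N \<J>
    \<and> (\<I> = \<J> \<and> closed_under_thickening \<I> \<longrightarrow>
         sparse_erosion_dist K M \<I> N \<J> \<le> erosion_dist K \<I> M N)
    \<and> (pmod_iso K M N \<or>
         (has_gpd K M intervals \<and> has_gpd K N intervals \<and>
          gpd K M intervals = gpd K N intervals \<and>
          (CARD('d) \<le> 2 \<or> (\<forall>I\<in>\<I> \<union> \<J>. \<forall>\<epsilon>\<ge>0. thickening \<epsilon> I \<in> intervals))) \<longrightarrow>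
         sparse_erosion_dist K M \<I> N \<J> = dhat \<I> \<J>)"
proof (intro conjI impI)
  show "dhat \<I> \<J> \<le> sparse_erosion_dist K M \<I> N \<J>"
    by (rule dhat_le_sparse_erosion_dist)
  show "sparse_erosion_dist K M \<I> N \<J> \<le> erosion_dist K \<I> M N"
    if "\<I> = \<J> \<and> closed_under_thickening \<I>"
    using that sparse_erosion_dist_le_erosion_dist by blast
  assume eq: "pmod_iso K M N \<or>
         (has_gpd K M intervals \<and> has_gpd K N intervals \<and>
          gpd K M intervals = gpd K N intervals \<and>
          (CARD('d) \<le> 2 \<or> (\<forall>I\<in>\<I> \<union> \<J>. \<forall>\<epsilon>\<ge>0. thickening \<epsilon> I \<in> intervals)))"
  have rk: "gen_rank K M (thickening \<epsilon> I) = gen_rank K N (thickening \<epsilon> I)"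
    if I: "I \<in> \<I> \<union> \<J>" and \<epsilon>: "\<epsilon> \<ge> 0" for I \<epsilon>
  proof -
    have int: "I \<in> intervals" using I assms(6,8) by blast
    show ?thesis
      using eq
    proof (elim disjE conjE)
      assume iso: "pmod_iso K M N"
      have "thickening \<epsilon> I \<noteq> {}" "poset_connected (thickening \<epsilon> I)"
        using int subset_thickening[OF \<epsilon>, of I] poset_connected_thickening[OF _ \<epsilon>, of I]
        by (auto simp: intervals_def)
      then show ?thesis
        using gen_rank_pmod_iso[OF assms(2,4) iso] by simp
    next
      assume gpd: "has_gpd K M intervals" "has_gpd K N intervals"
        "gpd K M intervals = gpd K N intervals" and "CARD('d) \<le> 2"
      then show ?thesis
        using gen_rank_eq_of_gpd_eq[OF gpd] thickening_interval[OF _ int \<epsilon>] by simp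
    next
      assume gpd: "has_gpd K M intervals" "has_gpd K N intervals"
        "gpd K M intervals = gpd K N intervals"
        and "\<forall>I\<in>\<I> \<union> \<J>. \<forall>\<epsilon>\<ge>0. thickening \<epsilon> I \<in> intervals"
      then show ?thesis
        using gen_rank_eq_of_gpd_eq[OF gpd] I \<epsilon> by blast
    qed
  qed
  show "sparse_erosion_dist K M \<I> N \<J> = dhat \<I> \<J>"
    using sparse_erosion_dist_le_dhat[OF assms(2,4,6,8) rk] dhat_le_sparse_erosion_dist
    by (rule antisym)
qed

end
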